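(* Let $H$ be a separable real Hilbert space with norm $\|\cdot\|$. Let $\Phi\colon H\to\,]-\infty,+\infty]$ be proper, lower semicontinuous and convex, and set $S_*=\operatorname{argmin}\Phi$ and $\Phi_*=\inf\Phi$. Let $(x^n)_{n\in\mathbb{N}}$ be a sequence of $H$-valued random variables on a probability space $(\Omega,\mathfrak{A},\mathsf{P})$ such that $x^0$ is constant with value in $\operatorname{dom}\Phi$ (this value is also denoted $x^0$) and, for every $n\in\mathbb{N}$, $\Phi(x^n)$ is $\mathsf{P}$-integrable. Consider the following conditions. P1. The sequence $(\mathsf{E}[\Phi(x^n)])_{n\in\mathbb{N}}$ is nonincreasing. P2. There exist a sequence $(\mathfrak{X}_n)_{n\in\mathbb{N}}$ of sub-sigma-algebras of $\mathfrak{A}$ such that, for every $n\in\mathbb{N}$, $\mathfrak{X}_n\subset\mathfrak{X}_{n+1}$ and $x^n$ is $\mathfrak{X}_n$-measurable, a sequence $(\xi_n)_{n\in\mathbb{N}}$ of $\mathfrak{X}_n$-measurable real-valued nonnegative random variables with $\sum_{n\in\mathbb{N}}\mathsf{E}[\xi_n]\le b<+\infty$, and $a>0$ such that, for every $x\in\operatorname{dom}\Phi$ and every $n\in\mathbb{N}$, $$\mathsf{E}[\|x^{n+1}-x\|^2\mid\mathfrak{X}_n]\le\|x^n-x\|^2+a\,\mathsf{E}[\Phi(x)-\Phi(x^{n+1})\mid\mathfrak{X}_n]+\xi_n\quad\mathsf{P}\text{-a.s.}$$ P3. There exist sequences $(y^n)_{n\in\mathbb{N}}$ and $(v^n)_{n\in\mathbb{N}}$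 of $H$-valued random variables such that, $\mathsf{P}$-a.s., $v^n\in\partial\Phi(y^n)$ for every $n\in\mathbb{N}$, $y^n-x^n\rightharpoonup0$, and $v^n\to0$. Assume that P1 holds and that, if $\inf_{n\in\mathbb{N}}\mathsf{E}[\Phi(x^n)]>-\infty$, then P2 holds. Then the following hold. (i) $\mathsf{E}[\Phi(x^n)]\to\Phi_*$. (ii) Suppose that $S_*\ne\varnothing$. Then $\mathsf{E}[\Phi(x^n)]-\Phi_*=o(1/n)$ and, for every integer $n\ge1$, $$\mathsf{E}[\Phi(x^n)]-\Phi_*\le\left[\frac{\mathrm{dist}^2(x^0,S_* )}{a}+\frac ba\right]\frac1n .$$ (iii) Suppose that P3 holds and $S_*\neq\varnothing$. Then there exists a random variable $x_*$ taking values in $S_*$ such that $x^n\rightharpoonup x_*$ $\mathsf{P}$-a.s.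
   Context: $\partial\Phi$ is the usual convex subdifferential, $\rightharpoonup$ denotes weak convergence and $\to$ strong convergence in $H$, and $\mathrm{dist}(x,S)=\inf_{z\in S}\|x-z\|$. *)

theory Defs
  imports "HOL-Probability.Probability" "HOL-Library.Landau_Symbols"
begin

definition proper_fun :: "('a \<Rightarrow> ereal) \<Rightarrow> bool" where
  "proper_fun \<Phi> \<longleftrightarrow> (\<forall>z. \<Phi> z \<noteq> -\<infinity>) \<and> (\<exists>z. \<Phi> z \<noteq> \<infinity>)"

definition lsc_fun :: "('a::topological_space \<Rightarrow> ereal) \<Rightarrow> bool" where
  "lsc_fun \<Phi> \<longleftrightarrow> (\<forall>z. \<Phi> z \<le> Liminf (at z) \<Phi>)"

definition convex_fun :: "('a::real_vector \<Rightarrow> ereal) \<Rightarrow> bool" where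
  "convex_fun \<Phi> \<longleftrightarrow>
     (\<forall>y z. \<forall>t\<in>{0<..<1::real}.
        \<Phi> ((1 - t) *\<^sub>R y + t *\<^sub>R z) \<le> ereal (1 - t) * \<Phi> y + ereal t * \<Phi> z)"

definition eff_dom :: "('a \<Rightarrow> ereal) \<Rightarrow> 'a set" where
  "eff_dom \<Phi> = {z. \<Phi> z < \<infinity>}"

definition argmin_set :: "('a \<Rightarrow> ereal) \<Rightarrow> 'a set" where
  "argmin_set \<Phi> = {z. is_arg_min \<Phi> (\<lambda>_. True) z}"

definition subdiff :: "('a::real_inner \<Rightarrow> ereal) \<Rightarrow> 'a \<Rightarrow> 'a set" where
  "subdiff \<Phi> y = {u. \<forall>z. ereal (inner (z - y) u) + \<Phi> y \<le> \<Phi> z}"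

definition weakly_tendsto :: "(nat \<Rightarrow> 'a::real_inner) \<Rightarrow> 'a \<Rightarrow> bool" where
  "weakly_tendsto X l \<longleftrightarrow> (\<forall>u. (\<lambda>n. inner (X n) u) \<longlonglongrightarrow> inner l u)"

definition ereal_integrable :: "'w measure \<Rightarrow> ('w \<Rightarrow> ereal) \<Rightarrow> bool" where
  "ereal_integrable M f \<longleftrightarrow>
     f \<in> borel_measurable M \<and> (\<integral>\<^sup>+\<omega>. e2ennreal \<bar>f \<omega>\<bar> \<partial>M) < \<infinity>"

text \<open>An integrable extended-real function is finite almost everywhere, so in the next two
  definitions the value that \<^const>\<open>real_of_ereal\<close> assigns to infinity is immaterial. Both are
  used for integrable functions only.\<close>

definition ereal_expectation :: "'w measure \<Rightarrow> ('w \<Rightarrow> ereal) \<Rightarrow> real" where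
  "ereal_expectation M f = (\<integral>\<omega>. real_of_ereal (f \<omega>) \<partial>M)"

definition ereal_cond_exp :: "'w measure \<Rightarrow> 'w measure \<Rightarrow> ('w \<Rightarrow> ereal) \<Rightarrow> 'w \<Rightarrow> real" where
  "ereal_cond_exp M F f = real_cond_exp M F (\<lambda>\<omega>. real_of_ereal (f \<omega>))"

text \<open>The squared distance on the left-hand side below is not assumed integrable. Its conditional
  expectation is therefore the one of a nonnegative random variable, with values in
  \<open>[0,\<infinity>]\<close>. The comparison takes place in \<^typ>\<open>ereal\<close> because the right-hand side
  is not known to be nonnegative.\<close>

definition cond_descent ::
  "'w measure \<Rightarrow> ('a::real_normed_vector \<Rightarrow> ereal) \<Rightarrow> (nat \<Rightarrow> 'w \<Rightarrow> 'a) \<Rightarrow> real \<Rightarrow> real \<Rightarrow> bool"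
where
  "cond_descent M \<Phi> x a b \<longleftrightarrow>
     (\<exists>(F :: nat \<Rightarrow> 'w measure) (\<xi> :: nat \<Rightarrow> 'w \<Rightarrow> real).
        (\<forall>n. subalgebra M (F n)) \<and>
        (\<forall>n. subalgebra (F (Suc n)) (F n)) \<and>
        (\<forall>n. x n \<in> borel_measurable (F n)) \<and>
        (\<forall>n. \<xi> n \<in> borel_measurable (F n)) \<and>
        (\<forall>n. \<forall>\<omega>\<in>space M. 0 \<le> \<xi> n \<omega>) \<and>
        (\<forall>n. integrable M (\<xi> n)) \<and>
        summable (\<lambda>n. \<integral>\<omega>. \<xi> n \<omega> \<partial>M) \<and>
        (\<Sum>n. \<integral>\<omega>. \<xi> n \<omega> \<partial>M) \<le> b \<and>
        a > 0 \<and>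
        (\<forall>z\<in>eff_dom \<Phi>. \<forall>n. AE \<omega> in M.
           enn2ereal (nn_cond_exp M (F n) (\<lambda>\<omega>'. ennreal ((norm (x (Suc n) \<omega>' - z))\<^sup>2)) \<omega>)
             \<le> ereal ((norm (x n \<omega> - z))\<^sup>2
                 + a * ereal_cond_exp M (F n) (\<lambda>\<omega>'. \<Phi> z - \<Phi> (x (Suc n) \<omega>')) \<omega>
                 + \<xi> n \<omega>)))"

definition asymp_critical ::
  "'w measure \<Rightarrow> ('a::real_inner \<Rightarrow> ereal) \<Rightarrow> (nat \<Rightarrow> 'w \<Rightarrow> 'a) \<Rightarrow> bool"
where
  "asymp_critical M \<Phi> x \<longleftrightarrow>
     (\<exists>(y :: nat \<Rightarrow> 'w \<Rightarrow> 'a) (v :: nat \<Rightarrow> 'w \<Rightarrow> 'a).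
        (\<forall>n. y n \<in> borel_measurable M) \<and>
        (\<forall>n. v n \<in> borel_measurable M) \<and>
        (AE \<omega> in M.
           (\<forall>n. v n \<omega> \<in> subdiff \<Phi> (y n \<omega>)) \<and>
           weakly_tendsto (\<lambda>n. y n \<omega> - x n \<omega>) 0 \<and>
           (\<lambda>n. v n \<omega>) \<longlonglongrightarrow> 0))"

end

theory Submission
  imports Defs
begin

text \<open>
  Integrating the descent inequality of P2 and telescoping bounds
  \<open>a (\<Sum>k=1..n. E[\<Phi> (x k)] - \<Phi> z)\<close> by \<open>\<parallel>x0 - z\<parallel>\<^sup>2 + b\<close> for every \<open>z\<close> in the domain. Since
  the expectations decrease, this gives the limit and the \<open>1/n\<close> bound; if \<open>z\<close> is a minimizer, the
  terms are nonnegative, decreasing and summable, hence \<open>o(1/n)\<close>.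

  For a minimizer \<open>z\<close>, the process \<open>\<parallel>x n - z\<parallel>\<^sup>2\<close> is a nonnegative supermartingale up to a summable
  error, so by Doob's upcrossing argument it converges almost surely, and by separability
  simultaneously for all minimizers. P3 and weak lower semicontinuity force weak cluster points to
  be minimizers, and Opial's lemma gives weak convergence.
\<close>

section \<open>Weak convergence in Hilbert spaces\<close>

text \<open>Three obstacles shape the proof. Integrability: the squared distances are not assumed
  integrable, so the conditional inequality cannot simply be integrated; since \<open>x 0\<close> is
  constant, integrability is carried along the recursion, each step dominating the next squared
  distance by an integrable right-hand side. Null sets: the event on which the distances to
  \<open>z\<close> converge depends on \<open>z\<close>, and there may be uncountably many
  minimizers. Measurability: Opial's lemma gives a limit separately for each path, chosen
  arbitrarily, so that it is a random variable needs its own argument. P2 is at hand only when the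
  expected values are bounded below; otherwise they pass under every level and (i) is
  immediate.\<close>

lemma weakly_bounded_imp_Bseq:
  fixes X :: "nat \<Rightarrow> 'a::{real_inner, banach}"
  assumes "\<And>u. Bseq (\<lambda>n. inner (X n) u)"
  shows "Bseq X"
proof -
  \<comment> \<open>Uniform boundedness by Baire: the closed sets of test vectors on which all
    products are bounded by \<open>k\<close> cover the space, so one of them contains a
    ball.\<close>
  define C where "C k = {u. \<forall>n. \<bar>inner (X n) u\<bar> \<le> real k}" for k
  have C: "closed (C k)" for k
    unfolding C_def Collect_all_eq
    by (intro closed_INT ballI closed_Collect_le continuous_intros)
  have "(\<Union>k. C k) = UNIV"
  proof (intro set_eqI iffI UNIV_I)
    fix u
    obtain K where K: "\<And>n. norm (inner (X n) u) \<le> K"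
      using assms[of u] by (auto simp: Bseq_def)
    obtain k where "K \<le> real k" using real_arch_simple by blast
    then have "u \<in> C k" using K by (fastforce simp: C_def intro: order_trans)
    then show "u \<in> (\<Union>k. C k)" by blast
  qed
  moreover have "interior (\<Union>(range C)) = {}" if "\<And>k. interior (C k) = {}"
    using Met_TC.metric_Baire_category_alt[of "range C"] that C complete_UNIV by auto
  ultimately obtain k where "interior (C k) \<noteq> {}" by fastforce
  then obtain u0 e where e: "e > 0" "cball u0 e \<subseteq> C k"
    unfolding mem_interior_cball ex_in_conv[symmetric] by blast
  have "norm (X n) \<le> 2 * real k / e" for n
  proof (cases "X n = 0")
    case False
    \<comment> \<open>Moving from the centre by \<open>e\<close> in the direction of
      \<open>X n\<close> stays in the ball and changes the product by \<open>e * norm (X n)\<close>.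
      Both values are at most \<open>k\<close> in modulus, whence \<open>2 * k / e\<close>.\<close>
    define w where "w = u0 + (e / norm (X n)) *\<^sub>R X n"
    have "w \<in> cball u0 e" "u0 \<in> cball u0 e"
      using False e by (auto simp: w_def dist_norm)
    then have "\<bar>inner (X n) w\<bar> \<le> k" "\<bar>inner (X n) u0\<bar> \<le> k"
      using subsetD[OF e(2)] by (auto simp: C_def)
    moreover have "inner (X n) w = inner (X n) u0 + e * norm (X n)"
      using False by (simp add: w_def inner_add_right power2_norm_eq_inner[symmetric] power2_eq_square)
    ultimately show ?thesis using e(1) by (simp add: field_simps)
  qed (use e in auto)
  then show ?thesis by (rule BseqI')
qed

text \<open>Almost norm-minimal points of the sets form a Cauchy sequence by the parallelogram law.\<close>

lemma nested_closed_convex_Inter_nonempty: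
  fixes C :: "nat \<Rightarrow> 'a::{real_inner, banach} set"
  assumes cl: "\<And>n. closed (C n)" and cv: "\<And>n. convex (C n)" and ne: "\<And>n. C n \<noteq> {}"
    and dec: "decseq C" and bd: "bounded (C 0)"
  shows "(\<Inter>n. C n) \<noteq> {}"
proof -
  define d where "d n = Inf (norm ` C n)" for n
  have bdd: "bdd_below (norm ` C n)" for n by (rule bdd_belowI[of _ 0]) auto
  have sub: "C m \<subseteq> C n" if "n \<le> m" for m n using dec that by (simp add: decseq_def)
  have dle: "d n \<le> norm c" if "c \<in> C n" for n c
    unfolding d_def using that bdd by (auto intro: cInf_lower)
  have d0: "0 \<le> d n" for n unfolding d_def using ne by (intro cInf_greatest) auto
  have inc: "incseq d"
    unfolding incseq_def d_def using ne bdd by (intro allI impI cInf_superset_mono image_mono sub) auto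
  obtain K where K: "\<And>c. c \<in> C 0 \<Longrightarrow> norm c \<le> K" using bd by (auto simp: bounded_iff)
  have "d n \<le> K" for n
    using dle K sub[of 0 n] ne[of n] by (meson all_not_in_conv order_trans subsetD zero_le)
  then obtain L where L: "d \<longlonglongrightarrow> L" "\<And>n. d n \<le> L" using incseq_convergent[OF inc] by blast
  have "\<exists>c\<in>C n. norm c < d n + 1 / real (Suc n)" for n
    using cInf_lessD[of "norm ` C n" "d n + 1 / real (Suc n)"] ne[of n] unfolding d_def by auto
  then obtain c where c: "\<And>n. c n \<in> C n" "\<And>n. norm (c n) < d n + 1 / real (Suc n)" by metis
  \<comment> \<open>The parallelogram bound for two chosen points with indices from \<open>n\<close>
    on: both norms are at most \<open>L + 1 / Suc n\<close>, and the midpoint lies in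
    \<open>C n\<close>, so its norm is at least \<open>d n\<close>.\<close>
  define g where "g n = 4 * (L + 1 / real (Suc n))\<^sup>2 - 4 * (d n)\<^sup>2" for n
  have "(\<lambda>n. g n) \<longlonglongrightarrow> 4 * (L + 0)\<^sup>2 - 4 * L\<^sup>2"
    unfolding g_def by (intro tendsto_intros L LIMSEQ_inverse_real_of_nat[unfolded inverse_eq_divide])
  then have g0: "g \<longlonglongrightarrow> 0" by simp
  have dist_le: "(dist (c m) (c n))\<^sup>2 \<le> g n" if "n \<le> m" for m n
  proof -
    let ?mid = "(1/2) *\<^sub>R c n + (1/2) *\<^sub>R c m"
    have "?mid \<in> C n" using cv[of n] c(1)[of n] c(1)[of m] sub[OF that]
      by (auto simp: convex_def)
    then have mid: "(d n)\<^sup>2 \<le> (norm ?mid)\<^sup>2" using dle d0 by (simp add: power_mono)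
    have "1 / real (Suc m) \<le> 1 / real (Suc n)" using that by (simp add: frac_le)
    then have "norm (c m) \<le> L + 1 / real (Suc n)" "norm (c n) \<le> L + 1 / real (Suc n)"
      using c(2)[of m] c(2)[of n] L(2)[of m] L(2)[of n] by linarith+
    then have "(norm (c m))\<^sup>2 \<le> (L + 1 / real (Suc n))\<^sup>2" "(norm (c n))\<^sup>2 \<le> (L + 1 / real (Suc n))\<^sup>2"
      by (auto intro: power_mono)
    moreover have "(dist (c m) (c n))\<^sup>2 = 2 * (norm (c m))\<^sup>2 + 2 * (norm (c n))\<^sup>2 - 4 * (norm ?mid)\<^sup>2"
      by (simp add: dist_norm power2_norm_eq_inner inner_simps inner_commute)
    ultimately show ?thesis using mid by (simp add: g_def)
  qed
  have "Cauchy c"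
  proof (rule metric_CauchyI)
    fix e :: real assume "e > 0"
    then have "eventually (\<lambda>n. g n < e\<^sup>2) sequentially" using g0 by (intro order_tendstoD) auto
    then obtain N where N: "\<And>n. n \<ge> N \<Longrightarrow> g n < e\<^sup>2" by (auto simp: eventually_sequentially)
    have "dist (c m) (c n) < e" if "n \<ge> N" "n \<le> m" for m n
      using dist_le[OF that(2)] N[OF that(1)] \<open>e > 0\<close>
      by (meson less_imp_le order_le_less_trans power_less_imp_less_base)
    then show "\<exists>N. \<forall>m\<ge>N. \<forall>n\<ge>N. dist (c m) (c n) < e"
      by (metis dist_commute nat_le_linear)
  qed
  then obtain p where p: "c \<longlonglongrightarrow> p" using convergent_eq_Cauchy convergent_def by blast
  have "p \<in> C n" for n
  proof (rule Lim_in_closed_set[OF cl _ _ p])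
    show "\<forall>\<^sub>F k in sequentially. c k \<in> C n"
      using eventually_ge_at_top[of n] by eventually_elim (use c(1) sub in blast)
  qed simp
  then show ?thesis by blast
qed

text \<open>A common point of the closed convex hulls of all tails must be the weak limit. This replaces
  Riesz representation, and also yields that closed convex sets are weakly closed.\<close>

lemma weakly_Cauchy_imp_weakly_tendsto:
  fixes X :: "nat \<Rightarrow> 'a::{real_inner, banach}"
  assumes conv: "\<And>u. convergent (\<lambda>n. inner (X n) u)"
  obtains l where "weakly_tendsto X l" "\<And>n. l \<in> closure (convex hull (X ` {n..}))"
proof -
  have "Bseq X" using weakly_bounded_imp_Bseq convergent_imp_Bseq[OF conv] by blast
  then have bd: "bounded (range X)" by (simp add: Bseq_eq_bounded)
  let ?C = "\<lambda>n. closure (convex hull (X ` {n..}))"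
  have "(\<Inter>n. ?C n) \<noteq> {}"
  proof (rule nested_closed_convex_Inter_nonempty)
    show "decseq ?C" unfolding decseq_def by (intro allI impI closure_mono hull_mono) auto
    show "bounded (?C 0)"
      using bd by (intro bounded_closure bounded_convex_hull) (auto elim: bounded_subset)
  qed (auto intro: convex_closure)
  then obtain p where p: "\<And>n. p \<in> ?C n" by blast
  have "(\<lambda>n. inner (X n) u) \<longlonglongrightarrow> inner p u" for u
  proof -
    obtain L where L: "(\<lambda>n. inner (X n) u) \<longlonglongrightarrow> L" using conv unfolding convergent_def by blast
    have "\<bar>inner p u - L\<bar> \<le> e" if e: "e > 0" for e
    proof -
      obtain N where N: "\<And>n. n \<ge> N \<Longrightarrow> dist (inner (X n) u) L < e"
        using L e unfolding lim_sequentially by blast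
      let ?T = "{w. inner u w \<le> L + e} \<inter> {w. inner u w \<ge> L - e}"
      have "X ` {N..} \<subseteq> ?T" using N by (fastforce simp: dist_real_def inner_commute)
      then have "?C N \<subseteq> ?T"
        by (intro closure_minimal hull_minimal closed_Int convex_Int convex_halfspace_le
            convex_halfspace_ge closed_halfspace_le closed_halfspace_ge)
      then have "p \<in> ?T" using p by blast
      then show ?thesis by (auto simp: inner_commute)
    qed
    then have "inner p u = L" by (metis abs_le_zero_iff dense_ge eq_iff_diff_eq_0)
    then show ?thesis using L by simp
  qed
  then show ?thesis using p that unfolding weakly_tendsto_def by blast
qed

lemma weakly_tendsto_unique:
  assumes "weakly_tendsto X l" "weakly_tendsto X l'"
  shows "l = l'"
proof -
  have "inner l u = inner l' u" for u
    using assms LIMSEQ_unique unfolding weakly_tendsto_def by blast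
  then show ?thesis using vector_eq_rdot by blast
qed

text \<open>Some closed hull of a tail lies in \<open>C\<close>, and the weak limit belongs to all
  these hulls. Applied to sublevel sets, this is weak lower semicontinuity of a convex
  function.\<close>

lemma weakly_tendsto_in_closed_convex:
  fixes X :: "nat \<Rightarrow> 'a::{real_inner, banach}"
  assumes "weakly_tendsto X l" "closed C" "convex C" "eventually (\<lambda>n. X n \<in> C) sequentially"
  shows "l \<in> C"
proof -
  have "convergent (\<lambda>n. inner (X n) u)" for u
    using assms(1) unfolding weakly_tendsto_def convergent_def by blast
  then obtain l' where l': "weakly_tendsto X l'" "\<And>n. l' \<in> closure (convex hull (X ` {n..}))"
    using weakly_Cauchy_imp_weakly_tendsto by blast
  obtain N where N: "\<And>n. n \<ge> N \<Longrightarrow> X n \<in> C" using assms(4) by (auto simp: eventually_sequentially)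
  then have "closure (convex hull (X ` {N..})) \<subseteq> C"
    using assms(2,3) by (intro closure_minimal hull_minimal) auto
  then show ?thesis using l' weakly_tendsto_unique[OF assms(1) l'(1)] by blast
qed

section \<open>Subsequences, weak sequential compactness and Opial's lemma\<close>

lemma weakly_tendsto_subseq:
  assumes "weakly_tendsto X l" "strict_mono r"
  shows "weakly_tendsto (X \<circ> r) l"
proof -
  have "(\<lambda>n. inner (X (r n)) u) \<longlonglongrightarrow> inner l u" for u
    using assms LIMSEQ_subseq_LIMSEQ[of "\<lambda>n. inner (X n) u" "inner l u" r]
    unfolding weakly_tendsto_def by (simp add: o_def)
  then show ?thesis by (simp add: weakly_tendsto_def)
qed

lemma weakly_tendsto_imp_Bseq:
  fixes X :: "nat \<Rightarrow> 'a::{real_inner, banach}"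
  assumes "weakly_tendsto X l"
  shows "Bseq X"
proof (rule weakly_bounded_imp_Bseq)
  show "Bseq (\<lambda>n. inner (X n) u)" for u
    using assms unfolding weakly_tendsto_def by (intro convergent_imp_Bseq convergentI) blast
qed

text \<open>A diagonal sequence makes the products with a countable dense set converge. The norm
  bound makes the products uniformly Lipschitz in the test vector, so they are Cauchy for every test
  vector.\<close>

lemma bounded_imp_weakly_convergent_subseq:
  fixes X :: "nat \<Rightarrow> 'a::{real_inner, banach, second_countable_topology}"
  assumes "Bseq X"
  obtains r l where "strict_mono (r :: nat \<Rightarrow> nat)" "weakly_tendsto (X \<circ> r) l"
proof -
  obtain K where K: "K > 0" "\<And>n. norm (X n) \<le> K" using assms by (auto simp: Bseq_def)
  obtain D :: "'a set" where D: "countable D" "\<And>U. open U \<Longrightarrow> U \<noteq> {} \<Longrightarrow> \<exists>d\<in>D. d \<in> U"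
    using countable_dense_setE by blast
  have "D \<noteq> {}" using D(2)[of UNIV] by auto
  define d where "d = from_nat_into D"
  have d: "range d = D" unfolding d_def using D(1) \<open>D \<noteq> {}\<close> by (simp add: range_from_nat_into)
  interpret subseqs "\<lambda>k s. convergent (\<lambda>n. inner (X (s n)) (d k))"
  proof
    fix k and s :: "nat \<Rightarrow> nat"
    have "bounded (range (\<lambda>n. inner (X (s n)) (d k)))"
      unfolding bounded_iff
      by (intro exI[of _ "K * norm (d k)"])
        (auto intro!: order_trans[OF Cauchy_Schwarz_ineq2] mult_right_mono K)
    from bounded_imp_convergent_subsequence[OF this]
    show "\<exists>r'. strict_mono r' \<and> convergent (\<lambda>n. inner (X ((s \<circ> r') n)) (d k))"
      by (auto simp: convergent_def o_def)
  qed
  have conv: "convergent (\<lambda>n. inner (X (diagseq n)) (d k))" for k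
  proof -
    \<comment> \<open>The diagonal sequence is known to be a subsequence of the extraction for
      \<open>d k\<close> only from index \<open>Suc k\<close> on; the initial segment is
      discarded.\<close>
    have "convergent (\<lambda>n. inner (X ((diagseq \<circ> (+) (Suc k)) n)) (d k))"
    proof (rule diagseq_holds)
      fix r s :: "nat \<Rightarrow> nat" and n
      assume "strict_mono r" "convergent (\<lambda>j. inner (X (s j)) (d n))"
      then show "convergent (\<lambda>j. inner (X ((s \<circ> r) j)) (d n))"
        using convergent_subseq_convergent[of "\<lambda>j. inner (X (s j)) (d n)" r] by (simp add: o_def)
    qed
    then show ?thesis
      using convergent_ignore_initial_segment[of "\<lambda>n. inner (X (diagseq n)) (d k)" "Suc k"]
      by (simp add: o_def add.commute)
  qed
  have "Cauchy (\<lambda>n. inner (X (diagseq n)) u)" for u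
  proof (rule metric_CauchyI)
    fix e :: real assume "e > 0"
    \<comment> \<open>Replacing \<open>u\<close> by \<open>d k\<close> costs at most
      \<open>e / 4\<close> at each of the two indices and leaves \<open>e / 2\<close> for the Cauchy
      property.\<close>
    then have "ball u (e / (4 * K)) \<noteq> {}" using K(1) by (simp add: not_le)
    then obtain k where k: "d k \<in> ball u (e / (4 * K))" using D(2)[OF open_ball] d by blast
    obtain N where N: "\<And>m n. m \<ge> N \<Longrightarrow> n \<ge> N \<Longrightarrow>
        dist (inner (X (diagseq m)) (d k)) (inner (X (diagseq n)) (d k)) < e / 2"
      using conv[of k] \<open>e > 0\<close> unfolding Cauchy_convergent_iff[symmetric] Cauchy_def
      by (meson half_gt_zero)
    have app: "\<bar>inner (X n) u - inner (X n) (d k)\<bar> \<le> e / 4" for n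
    proof -
      have "\<bar>inner (X n) (u - d k)\<bar> \<le> norm (X n) * norm (u - d k)" by (rule Cauchy_Schwarz_ineq2)
      also have "\<dots> \<le> K * (e / (4 * K))"
        using k K by (intro mult_mono) (auto simp: dist_norm)
      finally show ?thesis using K by (simp add: inner_diff_right)
    qed
    have "dist (inner (X (diagseq m)) u) (inner (X (diagseq n)) u) < e" if "m \<ge> N" "n \<ge> N" for m n
      using N[OF that] app[of "diagseq m"] app[of "diagseq n"] unfolding dist_real_def by linarith
    then show "\<exists>N. \<forall>m\<ge>N. \<forall>n\<ge>N. dist (inner (X (diagseq m)) u) (inner (X (diagseq n)) u) < e"
      by blast
  qed
  then have "convergent (\<lambda>n. inner ((X \<circ> diagseq) n) u)" for u
    by (simp add: Cauchy_convergent_iff)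
  then obtain l where "weakly_tendsto (X \<circ> diagseq) l"
    using weakly_Cauchy_imp_weakly_tendsto by blast
  then show ?thesis using that subseq_diagseq by blast
qed

lemma Bseq_if_convergent_norm_diff:
  fixes X :: "nat \<Rightarrow> 'a::real_normed_vector"
  assumes "convergent (\<lambda>n. (norm (X n - z))\<^sup>2)"
  shows "Bseq X"
proof -
  obtain K where K: "\<And>n. (norm (X n - z))\<^sup>2 \<le> K"
    using convergent_imp_Bseq[OF assms] unfolding Bseq_def by (auto simp: abs_le_iff)
  have "norm (X n) \<le> sqrt K + norm z" for n
    using norm_triangle_sub[of "X n" z] real_le_rsqrt[OF K[of n]] by linarith
  then show ?thesis by (rule BseqI')
qed

text \<open>The difference of the squared distances to \<open>p\<close> and \<open>q\<close> is
  affine in \<open>X n\<close>, with linear part a multiple of the product with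
  \<open>p - q\<close>. For cluster points this product converges along the whole sequence, and
  reading its limit along both subsequences gives \<open>p = q\<close>.\<close>

lemma Opial:
  fixes X :: "nat \<Rightarrow> 'a::{real_inner, banach, second_countable_topology}"
  assumes S: "S \<noteq> {}"
    and conv: "\<And>z. z \<in> S \<Longrightarrow> convergent (\<lambda>n. (norm (X n - z))\<^sup>2)"
    and cluster: "\<And>r l. strict_mono r \<Longrightarrow> weakly_tendsto (X \<circ> r) l \<Longrightarrow> l \<in> S"
  obtains l where "l \<in> S" "weakly_tendsto X l"
proof -
  obtain z where "z \<in> S" using S by blast
  then have "Bseq X" by (rule Bseq_if_convergent_norm_diff[OF conv])
  have same: "p = q" if r: "strict_mono r" "strict_mono s"
    and p: "weakly_tendsto (X \<circ> r) p" and q: "weakly_tendsto (X \<circ> s) q" for r s p q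
  proof -
    have "p \<in> S" "q \<in> S" using cluster that by blast+
    then have "convergent (\<lambda>n. (1/2) * ((norm (X n - q))\<^sup>2 - (norm (X n - p))\<^sup>2 - (norm q)\<^sup>2 + (norm p)\<^sup>2))"
      by (intro convergent_mult convergent_add convergent_diff convergent_const conv)
    also have "(\<lambda>n. (1/2) * ((norm (X n - q))\<^sup>2 - (norm (X n - p))\<^sup>2 - (norm q)\<^sup>2 + (norm p)\<^sup>2))
      = (\<lambda>n. inner (X n) (p - q))"
      by (rule ext) (simp add: power2_norm_eq_inner inner_simps inner_commute diff_divide_distrib)
    finally obtain L where L: "(\<lambda>n. inner (X n) (p - q)) \<longlonglongrightarrow> L" unfolding convergent_def by blast
    have "inner p (p - q) = L" "inner q (p - q) = L"
      using p q LIMSEQ_subseq_LIMSEQ[OF L r(1)] LIMSEQ_subseq_LIMSEQ[OF L r(2)] LIMSEQ_unique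
      unfolding weakly_tendsto_def o_def by blast+
    then have "inner (p - q) (p - q) = 0" by (simp add: inner_diff_left)
    then show ?thesis by simp
  qed
  obtain r p where rp: "strict_mono r" "weakly_tendsto (X \<circ> r) p"
    using bounded_imp_weakly_convergent_subseq[OF \<open>Bseq X\<close>] by blast
  have "(\<lambda>n. inner (X n) u) \<longlonglongrightarrow> inner p u" for u
  proof (rule ccontr)
    assume "\<not> ?thesis"
    then obtain e where e: "e > 0" "\<And>N. \<exists>n\<ge>N. \<not> dist (inner (X n) u) (inner p u) < e"
      unfolding lim_sequentially by blast
    \<comment> \<open>Infinitely many indices stay at distance at least \<open>e\<close>. Along them
      a further subsequence has a weak limit, which must be \<open>p\<close> again.\<close>
    define I where "I = {n. \<not> dist (inner (X n) u) (inner p u) < e}"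
    have "infinite I" unfolding infinite_nat_iff_unbounded_le I_def using e(2) by blast
    then have s: "strict_mono (enumerate I)" "\<And>n. enumerate I n \<in> I"
      by (auto simp: strict_mono_enumerate enumerate_in_set)
    have "Bseq (X \<circ> enumerate I)" using Bseq_subseq[OF \<open>Bseq X\<close>, of "enumerate I"] by (simp add: o_def)
    then obtain t q where tq: "strict_mono t" "weakly_tendsto ((X \<circ> enumerate I) \<circ> t) q"
      using bounded_imp_weakly_convergent_subseq by blast
    then have "p = q"
      using same[OF rp(1) strict_mono_o[OF s(1) tq(1)] rp(2)] by (simp add: o_assoc)
    then have "(\<lambda>n. inner (X (enumerate I (t n))) u) \<longlonglongrightarrow> inner p u"
      using tq(2) unfolding weakly_tendsto_def by simp
    then obtain n where "dist (inner (X (enumerate I (t n))) u) (inner p u) < e"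
      using e(1) unfolding lim_sequentially by blast
    then show False using s(2)[of "t n"] by (simp add: I_def)
  qed
  then show ?thesis using that cluster[OF rp] unfolding weakly_tendsto_def by blast
qed

section \<open>Almost sure convergence of quasi-supermartingales\<close>

text \<open>The betting strategy of Doob's upcrossing argument: start holding when the path falls below
  \<open>\<alpha>\<close>, stop when it rises above \<open>\<beta>\<close>.\<close>

fun upcross_hold :: "real \<Rightarrow> real \<Rightarrow> (nat \<Rightarrow> real) \<Rightarrow> nat \<Rightarrow> bool" where
  "upcross_hold \<alpha> \<beta> y 0 \<longleftrightarrow> y 0 < \<alpha>"
| "upcross_hold \<alpha> \<beta> y (Suc n) \<longleftrightarrow> (if upcross_hold \<alpha> \<beta> y n then y (Suc n) \<le> \<beta> else y (Suc n) < \<alpha>)"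

fun upcrossings :: "real \<Rightarrow> real \<Rightarrow> (nat \<Rightarrow> real) \<Rightarrow> nat \<Rightarrow> nat" where
  "upcrossings \<alpha> \<beta> y 0 = 0"
| "upcrossings \<alpha> \<beta> y (Suc n) =
    upcrossings \<alpha> \<beta> y n + (if upcross_hold \<alpha> \<beta> y n \<and> \<beta> < y (Suc n) then 1 else 0)"

text \<open>The right-hand side is the gain of the strategy. Each completed crossing earns at least
  \<open>\<beta> - \<alpha>\<close>, and a position still open at time \<open>n\<close> loses at
  most \<open>\<alpha>\<close> because the path is nonnegative.\<close>

lemma upcrossings_le_gain:
  assumes "0 \<le> \<alpha>" "\<And>k. 0 \<le> y k"
  shows "(\<beta> - \<alpha>) * real (upcrossings \<alpha> \<beta> y n) - \<alpha>
    \<le> (\<Sum>k<n. of_bool (upcross_hold \<alpha> \<beta> y k) * (y (Suc k) - y k))"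
proof -
  \<comment> \<open>While holding, the gain since the last purchase is at least \<open>y n - \<alpha>\<close>.\<close>
  have "(\<beta> - \<alpha>) * real (upcrossings \<alpha> \<beta> y n) + (if upcross_hold \<alpha> \<beta> y n then y n - \<alpha> else 0)
    \<le> (\<Sum>k<n. of_bool (upcross_hold \<alpha> \<beta> y k) * (y (Suc k) - y k))"
    by (induction n) (auto simp: algebra_simps)
  moreover have "- \<alpha> \<le> (if upcross_hold \<alpha> \<beta> y n then y n - \<alpha> else 0)" using assms by simp
  ultimately show ?thesis by linarith
qed

lemma incseq_upcrossings: "incseq (upcrossings \<alpha> \<beta> y)"
  by (rule incseq_SucI) simp

text \<open>After the last crossing no position is closed any more: either the path never falls
  below \<open>\<alpha>\<close> again, or from such a fall on a position is held forever and the
  path stays at most \<open>\<beta>\<close>.\<close>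

lemma finite_upcrossings_imp_no_oscillation:
  assumes "\<alpha> < \<beta>" "\<And>n. upcrossings \<alpha> \<beta> y n \<le> K"
  shows "eventually (\<lambda>n. \<alpha> \<le> y n) sequentially \<or> eventually (\<lambda>n. y n \<le> \<beta>) sequentially"
proof -
  let ?U = "upcrossings \<alpha> \<beta> y"
  have fin: "finite (range ?U)" using assms(2) by (auto intro: finite_subset[OF _ finite_atMost[of K]])
  then obtain N where N: "?U N = Max (range ?U)" using Max_in[OF fin] by fastforce
  have const: "?U n = ?U N" if "n \<ge> N" for n
    using incseq_upcrossings[of \<alpha> \<beta> y, THEN incseqD, OF that] N Max_ge[OF fin, of "?U n"]
    by (intro antisym) auto
  have stay: "y (Suc m) \<le> \<beta>" if "m \<ge> N" "upcross_hold \<alpha> \<beta> y m" for m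
    using const[of m] const[of "Suc m"] that by (auto split: if_splits)
  show ?thesis
  proof (cases "\<exists>n>N. y n < \<alpha>")
    case True
    then obtain n where n: "n > N" "y n < \<alpha>" by blast
    \<comment> \<open>Both branches of the recursion agree here: buying needs
      \<open>y n < \<alpha>\<close>, keeping needs \<open>y n \<le> \<beta>\<close>, and
      \<open>\<alpha> < \<beta>\<close>.\<close>
    have hold_n: "upcross_hold \<alpha> \<beta> y n" using n assms(1) by (cases n) auto
    have hold: "upcross_hold \<alpha> \<beta> y m" if "m \<ge> n" for m
      using that
    proof (induction rule: dec_induct)
      case base
      show ?case by (rule hold_n)
    next
      case (step m)
      then show ?case using stay[of m] n by simp
    qed
    have "y m \<le> \<beta>" if "m \<ge> Suc n" for m
      using stay[of "m - 1"] hold[of "m - 1"] that n by (cases m) auto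
    then show ?thesis unfolding eventually_sequentially by blast
  next
    case False
    then show ?thesis unfolding eventually_sequentially by (metis Suc_le_eq not_less)
  qed
qed

text \<open>The decision at time \<open>n\<close> looks only at values up to \<open>n\<close>. This
  makes the holding event an admissible test set for the inequality between times \<open>n\<close>
  and \<open>Suc n\<close>.\<close>

lemma upcross_hold_measurable:
  assumes sub: "\<And>n. subalgebra (F (Suc n)) (F n)"
    and Y: "\<And>n. Y n \<in> borel_measurable (F n)"
  shows "{\<omega>\<in>space (F n). upcross_hold \<alpha> \<beta> (\<lambda>k. Y k \<omega>) n} \<in> sets (F n)"
proof (induction n)
  case 0
  note Y[measurable]
  show ?case by simp
next
  case (Suc n)
  have "Measurable.pred (F n) (\<lambda>\<omega>. upcross_hold \<alpha> \<beta> (\<lambda>k. Y k \<omega>) n)"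
    using Suc by (simp add: pred_def)
  from measurable_from_subalg[OF sub this]
  have [measurable]: "Measurable.pred (F (Suc n)) (\<lambda>\<omega>. upcross_hold \<alpha> \<beta> (\<lambda>k. Y k \<omega>) n)" .
  note Y[measurable]
  show ?case by simp
qed

lemma upcrossings_measurable:
  assumes "\<And>n. Y n \<in> borel_measurable M"
  shows "(\<lambda>\<omega>. upcrossings \<alpha> \<beta> (\<lambda>k. Y k \<omega>) n) \<in> measurable M (count_space UNIV)"
proof (induction n)
  case (Suc n)
  have [measurable]: "Measurable.pred M (\<lambda>\<omega>. upcross_hold \<alpha> \<beta> (\<lambda>k. Y k \<omega>) n)"
    using upcross_hold_measurable[of "\<lambda>_. M" Y] assms by (simp add: pred_def subalgebra_def)
  note assms[measurable] Suc[measurable]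
  show ?case by simp
qed simp

text \<open>In \<open>ennreal\<close> the lower and upper limits exist without a prior bound. A gap
  between them would contain two rational levels between which the path oscillates; a finite lower
  limit excludes divergence to infinity. Rational levels keep the number of exceptional null sets
  countable.\<close>

lemma convergent_if_no_rational_oscillation:
  fixes y :: "nat \<Rightarrow> real"
  assumes nonneg: "\<And>n. 0 \<le> y n" and fin: "liminf (\<lambda>n. ennreal (y n)) < \<infinity>"
    and osc: "\<And>\<alpha> \<beta>. \<alpha> \<in> \<rat> \<Longrightarrow> \<beta> \<in> \<rat> \<Longrightarrow> 0 \<le> \<alpha> \<Longrightarrow> \<alpha> < \<beta> \<Longrightarrow>
      eventually (\<lambda>n. \<alpha> \<le> y n) sequentially \<or> eventually (\<lambda>n. y n \<le> \<beta>) sequentially"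
  shows "convergent y"
proof -
  let ?l = "liminf (\<lambda>n. ennreal (y n))" and ?u = "limsup (\<lambda>n. ennreal (y n))"
  have "?u \<le> ?l"
  proof (rule ccontr)
    assume "\<not> ?u \<le> ?l"
    then have "?l < ?u" by simp
    then obtain p :: rat where p: "?l < real_of_rat p" "real_of_rat p < ?u"
      using ennreal_rat_dense by blast
    then obtain q :: rat where q: "real_of_rat p < ennreal (real_of_rat q)" "ennreal (real_of_rat q) < ?u"
      using ennreal_rat_dense by blast
    have "real_of_rat p > 0" using p(1) by (metis ennreal_neg not_le not_less_zero)
    then have "real_of_rat p < real_of_rat q" using q(1) by (simp add: ennreal_less_iff)
    with osc[of "real_of_rat p" "real_of_rat q"] \<open>real_of_rat p > 0\<close>
    consider "eventually (\<lambda>n. real_of_rat p \<le> y n) sequentially"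
      | "eventually (\<lambda>n. y n \<le> real_of_rat q) sequentially" by auto
    then show False
    proof cases
      case 1
      then have "eventually (\<lambda>n. ennreal (real_of_rat p) \<le> ennreal (y n)) sequentially"
        by eventually_elim (rule ennreal_leI)
      then have "ennreal (real_of_rat p) \<le> ?l" by (rule Liminf_bounded)
      then show False using p(1) by simp
    next
      case 2
      then have "eventually (\<lambda>n. ennreal (y n) \<le> ennreal (real_of_rat q)) sequentially"
        by eventually_elim (rule ennreal_leI)
      then have "?u \<le> ennreal (real_of_rat q)" by (rule Limsup_bounded)
      then show False using q(2) by simp
    qed
  qed
  then have "?u = ?l" using Liminf_le_Limsup[of sequentially "\<lambda>n. ennreal (y n)"] by (intro antisym) auto
  then have "(\<lambda>n. ennreal (y n)) \<longlonglongrightarrow> ?l" by (intro Liminf_eq_Limsup) auto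
  moreover obtain L where "?l = ennreal L" "0 \<le> L" using fin by (cases ?l) auto
  ultimately have "y \<longlonglongrightarrow> L" using nonneg by (simp add: tendsto_ennreal_iff)
  then show ?thesis by (rule convergentI)
qed

text \<open>The supermartingale property is integrated over events of \<open>F n\<close>, with an
  error that does not depend on the event. Summed over the holding events it bounds the expected
  number of upcrossings independently of the time horizon. Fatou's lemma gives the finite lower
  limit.\<close>

lemma (in prob_space) quasi_supermartingale_AE_convergent:
  fixes Y :: "nat \<Rightarrow> 'a \<Rightarrow> real"
  assumes F: "\<And>n. subalgebra M (F n)" "\<And>n. subalgebra (F (Suc n)) (F n)"
    and meas: "\<And>n. Y n \<in> borel_measurable (F n)"
    and nonneg: "\<And>n \<omega>. 0 \<le> Y n \<omega>"
    and int: "\<And>n. integrable M (Y n)"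
    and e: "summable e" "\<And>n. 0 \<le> e n"
    and le: "\<And>n A. A \<in> sets (F n) \<Longrightarrow>
      (\<integral>\<omega>. indicator A \<omega> * Y (Suc n) \<omega> \<partial>M) \<le> (\<integral>\<omega>. indicator A \<omega> * Y n \<omega> \<partial>M) + e n"
  shows "AE \<omega> in M. convergent (\<lambda>n. Y n \<omega>)"
proof -
  have [measurable]: "Y n \<in> borel_measurable M" for n
    using int by simp
  have sp: "space (F n) = space M" for n using F(1) by (simp add: subalgebra_def)
  have esum: "(\<Sum>k<n. e k) \<le> suminf e" for n using e by (intro sum_le_suminf) auto
  have bound: "(\<integral>\<omega>. Y n \<omega> \<partial>M) \<le> (\<integral>\<omega>. Y 0 \<omega> \<partial>M) + suminf e" for n
  proof -
    have "(\<integral>\<omega>. Y n \<omega> \<partial>M) \<le> (\<integral>\<omega>. Y 0 \<omega> \<partial>M) + (\<Sum>k<n. e k)"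
    proof (induction n)
      case (Suc n)
      have "(\<integral>\<omega>. indicator (space M) \<omega> * Y k \<omega> \<partial>M) = (\<integral>\<omega>. Y k \<omega> \<partial>M)" for k
        by (intro Bochner_Integration.integral_cong) auto
      then show ?case using Suc le[of "space M" n] sp[of n] sets.top[of "F n"] by simp
    qed simp
    then show ?thesis using esum[of n] by linarith
  qed
  have "(\<integral>\<^sup>+\<omega>. liminf (\<lambda>n. ennreal (Y n \<omega>)) \<partial>M) \<le> liminf (\<lambda>n. \<integral>\<^sup>+\<omega>. ennreal (Y n \<omega>) \<partial>M)"
    by (intro nn_integral_liminf) simp
  also have "\<dots> \<le> liminf (\<lambda>n. ennreal ((\<integral>\<omega>. Y 0 \<omega> \<partial>M) + suminf e))"
    using bound by (intro Liminf_mono always_eventually allI)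
      (simp add: nn_integral_eq_integral[OF int] nonneg ennreal_leI)
  also have "\<dots> < \<infinity>" by (simp add: Liminf_const)
  finally have "AE \<omega> in M. liminf (\<lambda>n. ennreal (Y n \<omega>)) \<noteq> \<infinity>"
    by (intro nn_integral_noteq_infinite) auto
  moreover have "AE \<omega> in M. eventually (\<lambda>n. \<alpha> \<le> Y n \<omega>) sequentially
      \<or> eventually (\<lambda>n. Y n \<omega> \<le> \<beta>) sequentially" if ab: "0 \<le> \<alpha>" "\<alpha> < \<beta>" for \<alpha> \<beta>
  proof -
    let ?N = "\<lambda>n \<omega>. upcrossings \<alpha> \<beta> (\<lambda>k. Y k \<omega>) n"
    let ?H = "\<lambda>k. {\<omega>\<in>space M. upcross_hold \<alpha> \<beta> (\<lambda>k. Y k \<omega>) k}"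
    note upcrossings_measurable[measurable]
    have H: "?H k \<in> sets (F k)" for k
      using upcross_hold_measurable[of F Y, OF F(2) meas] sp by simp
    then have HM [measurable]: "?H k \<in> sets M" for k
      using F(1) by (meson subalgebra_def subsetD)
    have intH: "integrable M (\<lambda>\<omega>. indicator (?H k) \<omega> * Y j \<omega>)" for k j
      using integrable_real_mult_indicator[OF HM int] by (simp add: mult.commute)
    have "(\<integral>\<^sup>+\<omega>. ennreal (real (?N n \<omega>)) \<partial>M) \<le> ennreal ((suminf e + \<alpha>) / (\<beta> - \<alpha>))" for n
    proof -
      let ?G = "\<lambda>\<omega>. \<Sum>k<n. indicator (?H k) \<omega> * Y (Suc k) \<omega> - indicator (?H k) \<omega> * Y k \<omega>"
      have intG: "integrable M ?G" using intH by auto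
      have "(\<integral>\<omega>. ?G \<omega> \<partial>M) \<le> (\<Sum>k<n. e k)"
        using le[OF H] intH by (simp add: sum_mono algebra_simps)
      then have G: "(\<integral>\<omega>. (?G \<omega> + \<alpha>) / (\<beta> - \<alpha>) \<partial>M) \<le> (suminf e + \<alpha>) / (\<beta> - \<alpha>)"
        using intG esum[of n] ab by (simp add: prob_space divide_right_mono)
      have NG: "real (?N n \<omega>) \<le> (?G \<omega> + \<alpha>) / (\<beta> - \<alpha>)" if "\<omega> \<in> space M" for \<omega>
      proof -
        have "?G \<omega> = (\<Sum>k<n. of_bool (upcross_hold \<alpha> \<beta> (\<lambda>k. Y k \<omega>) k) * (Y (Suc k) \<omega> - Y k \<omega>))"
          using that by (intro sum.cong) (auto simp: indicator_def)
        then show ?thesis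
          using upcrossings_le_gain[of \<alpha> "\<lambda>k. Y k \<omega>" \<beta> n] nonneg ab by (simp add: field_simps)
      qed
      have "(\<integral>\<^sup>+\<omega>. ennreal (real (?N n \<omega>)) \<partial>M) \<le> (\<integral>\<^sup>+\<omega>. ennreal ((?G \<omega> + \<alpha>) / (\<beta> - \<alpha>)) \<partial>M)"
        using NG by (intro nn_integral_mono ennreal_leI)
      also have "\<dots> = ennreal (\<integral>\<omega>. (?G \<omega> + \<alpha>) / (\<beta> - \<alpha>) \<partial>M)"
      proof (rule nn_integral_eq_integral)
        show "integrable M (\<lambda>\<omega>. (?G \<omega> + \<alpha>) / (\<beta> - \<alpha>))" using intG by simp
        show "AE \<omega> in M. 0 \<le> (?G \<omega> + \<alpha>) / (\<beta> - \<alpha>)"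
          by (rule AE_I2) (rule order_trans[OF of_nat_0_le_iff NG])
      qed
      also have "\<dots> \<le> ennreal ((suminf e + \<alpha>) / (\<beta> - \<alpha>))" using G by (rule ennreal_leI)
      finally show ?thesis .
    qed
    \<comment> \<open>The number of upcrossings grows with the horizon, so monotone convergence
      passes the bound on to its supremum.\<close>
    moreover have "(\<integral>\<^sup>+\<omega>. (SUP n. ennreal (real (?N n \<omega>))) \<partial>M) = (SUP n. \<integral>\<^sup>+\<omega>. ennreal (real (?N n \<omega>)) \<partial>M)"
      using incseq_upcrossings
      by (intro nn_integral_monotone_convergence_SUP)
        (auto simp: incseq_def le_fun_def intro!: ennreal_leI)
    ultimately have "(\<integral>\<^sup>+\<omega>. (SUP n. ennreal (real (?N n \<omega>))) \<partial>M) \<le> ennreal ((suminf e + \<alpha>) / (\<beta> - \<alpha>))"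
      by (simp add: SUP_le_iff)
    also have "\<dots> < \<infinity>" by simp
    finally have "AE \<omega> in M. (SUP n. ennreal (real (?N n \<omega>))) \<noteq> \<infinity>"
      by (intro nn_integral_noteq_infinite) auto
    then show ?thesis
    proof eventually_elim
      case (elim \<omega>)
      then obtain c where c: "(SUP n. ennreal (real (?N n \<omega>))) = ennreal c" "0 \<le> c"
        by (cases "SUP n. ennreal (real (?N n \<omega>))") auto
      have "real (?N n \<omega>) \<le> c" for n
        using SUP_upper[of n UNIV "\<lambda>n. ennreal (real (?N n \<omega>))"] c by simp
      then have "?N n \<omega> \<le> nat \<lfloor>c\<rfloor>" for n by (simp add: le_nat_floor)
      then show ?case by (rule finite_upcrossings_imp_no_oscillation[OF ab(2)])
    qed
  qed
  then have "AE \<omega> in M. \<forall>\<alpha>\<in>\<rat> \<inter> {0..}. \<forall>\<beta>\<in>\<rat> \<inter> {\<alpha><..}. eventually (\<lambda>n. \<alpha> \<le> Y n \<omega>) sequentially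
      \<or> eventually (\<lambda>n. Y n \<omega> \<le> \<beta>) sequentially"
    by (intro AE_ball_countable[THEN iffD2] ballI) (auto simp: countable_rat intro: countable_Int1)
  ultimately show ?thesis
  proof eventually_elim
    case (elim \<omega>)
    then show ?case
      using nonneg by (intro convergent_if_no_rational_oscillation) (auto simp: top.not_eq_extremum)
  qed
qed

text \<open>A closed ball is cut out by countably many half-spaces with normals in a dense set.\<close>

lemma borel_measurable_if_inner_measurable:
  fixes f :: "'w \<Rightarrow> 'a::{real_inner, second_countable_topology}"
  assumes [measurable]: "\<And>u. (\<lambda>\<omega>. inner (f \<omega>) u) \<in> borel_measurable M"
  shows "f \<in> borel_measurable M"
proof (rule borel_measurableI)
  fix S :: "'a set" assume "open S"
  obtain D :: "'a set" where D: "countable D" "\<And>U. open U \<Longrightarrow> U \<noteq> {} \<Longrightarrow> \<exists>d\<in>D. d \<in> U"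
    using countable_dense_setE by blast
  have cball: "w \<in> cball c r \<longleftrightarrow> (\<forall>d\<in>D. inner w d - inner c d \<le> r * norm d)" if "r > 0" for w c r
  proof
    assume "w \<in> cball c r"
    then have "norm (w - c) \<le> r" by (simp add: dist_norm norm_minus_commute)
    then have "inner (w - c) d \<le> r * norm d" for d
      by (meson mult_right_mono norm_cauchy_schwarz norm_ge_zero order_trans)
    then show "\<forall>d\<in>D. inner w d - inner c d \<le> r * norm d" by (simp add: inner_diff_left)
  next
    assume *: "\<forall>d\<in>D. inner w d - inner c d \<le> r * norm d"
    \<comment> \<open>The half-space condition is closed in \<open>d\<close>, so it extends from the
      dense set to all \<open>d\<close>; the choice \<open>d = w - c\<close> returns the norm
      bound.\<close>
    have "closed {d. inner (w - c) d \<le> r * norm d}"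
      by (intro closed_Collect_le continuous_intros)
    then have "- {d. inner (w - c) d \<le> r * norm d} = {}"
      using D(2)[of "- {d. inner (w - c) d \<le> r * norm d}"] * by (auto simp: inner_diff_left)
    then have "inner (w - c) (w - c) \<le> r * norm (w - c)" by blast
    then have "norm (w - c) * norm (w - c) \<le> r * norm (w - c)"
      by (simp add: power2_norm_eq_inner[symmetric] power2_eq_square)
    then have "norm (w - c) \<le> r"
      using that by (cases "w = c") (auto simp: mult_le_cancel_right)
    then show "w \<in> cball c r" by (simp add: dist_norm norm_minus_commute)
  qed
  define I where "I = {(c, q). c \<in> D \<and> q \<in> \<rat> \<and> 0 < q \<and> cball c q \<subseteq> S}"
  have "countable I"
    by (rule countable_subset[of _ "D \<times> \<rat>"]) (auto simp: I_def D countable_rat)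
  have "S = (\<Union>p\<in>I. cball (fst p) (snd p))"
  proof (intro equalityI subsetI)
    fix w assume "w \<in> S"
    then obtain e where e: "e > 0" "cball w e \<subseteq> S" using \<open>open S\<close> open_contains_cball by blast
    obtain q where q: "q \<in> \<rat>" "0 < q" "q < e / 2" using Rats_dense_in_real[of 0 "e/2"] e by auto
    obtain d where d: "d \<in> D" "d \<in> ball w q" using D(2)[of "ball w q"] q by auto
    have "cball d q \<subseteq> cball w e"
    proof
      fix v assume "v \<in> cball d q"
      then show "v \<in> cball w e" using d q dist_triangle[of w v d] by auto
    qed
    then have "(d, q) \<in> I" using d q e by (auto simp: I_def)
    moreover have "w \<in> cball d q" using d by (simp add: dist_commute)
    ultimately show "w \<in> (\<Union>p\<in>I. cball (fst p) (snd p))" by force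
  qed (auto simp: I_def)
  then have "f -` S \<inter> space M = (\<Union>p\<in>I. {\<omega>\<in>space M. f \<omega> \<in> cball (fst p) (snd p)})" by blast
  also have "\<dots> = (\<Union>p\<in>I. {\<omega>\<in>space M. \<forall>d\<in>D. inner (f \<omega>) d - inner (fst p) d \<le> snd p * norm d})"
    by (intro SUP_cong refl Collect_cong conj_cong cball) (auto simp: I_def)
  also have "\<dots> \<in> sets M"
  proof (rule sets.countable_UN'[OF \<open>countable I\<close>])
    show "(\<lambda>p. {\<omega>\<in>space M. \<forall>d\<in>D. inner (f \<omega>) d - inner (fst p) d \<le> snd p * norm d}) ` I \<subseteq> sets M"
      using D(1) by (auto intro!: sets.sets_Collect_countable_Ball)
  qed
  finally show "f -` S \<inter> space M \<in> sets M" .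
qed

section \<open>Minimizers of convex functions\<close>

lemma closed_sublevel:
  assumes "lsc_fun \<Phi>"
  shows "closed {z. \<Phi> z \<le> c}"
proof -
  have "open {z. c < \<Phi> z}"
  proof (subst open_subopen, rule ballI)
    fix z assume "z \<in> {z. c < \<Phi> z}"
    then have z: "c < \<Phi> z" by simp
    also have "\<dots> \<le> Liminf (at z) \<Phi>" using assms by (simp add: lsc_fun_def)
    finally have "eventually (\<lambda>y. c < \<Phi> y) (at z)" by (rule less_LiminfD)
    then have "eventually (\<lambda>y. c < \<Phi> y) (nhds z)" using z by (simp add: eventually_nhds_conv_at)
    then show "\<exists>T. open T \<and> z \<in> T \<and> T \<subseteq> {z. c < \<Phi> z}" by (auto simp: eventually_nhds)
  qed
  moreover have "{z. \<Phi> z \<le> c} = - {z. c < \<Phi> z}" by auto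
  ultimately show ?thesis by (simp add: closed_def)
qed

lemma convex_sublevel:
  assumes "convex_fun \<Phi>"
  shows "convex {z. \<Phi> z \<le> ereal c}"
proof (unfold convex_alt, intro ballI allI impI)
  fix y z and t :: real
  assume yz: "y \<in> {z. \<Phi> z \<le> ereal c}" "z \<in> {z. \<Phi> z \<le> ereal c}" and t: "0 \<le> t \<and> t \<le> 1"
  \<comment> \<open>\<open>convex_fun\<close> speaks only of \<open>0 < t < 1\<close>, which avoids
    products of 0 with infinity; the endpoints are treated directly.\<close>
  consider "t = 0" | "t = 1" | "t \<in> {0<..<1}" using t by fastforce
  then show "(1 - t) *\<^sub>R y + t *\<^sub>R z \<in> {z. \<Phi> z \<le> ereal c}"
  proof cases
    case 3
    then have "\<Phi> ((1 - t) *\<^sub>R y + t *\<^sub>R z) \<le> ereal (1 - t) * \<Phi> y + ereal t * \<Phi> z"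
      using assms by (simp add: convex_fun_def)
    also have "\<dots> \<le> ereal (1 - t) * ereal c + ereal t * ereal c"
      using yz 3 by (intro add_mono ereal_mult_left_mono) auto
    also have "\<dots> = ereal c" by (simp add: algebra_simps)
    finally show ?thesis by simp
  qed (use yz in auto)
qed

lemma argmin_set_iff: "z \<in> argmin_set \<Phi> \<longleftrightarrow> (\<forall>y. \<Phi> z \<le> \<Phi> y)" for \<Phi> :: "'a \<Rightarrow> ereal"
  by (auto simp: argmin_set_def is_arg_min_linorder)

lemma argmin_set_INF:
  fixes \<Phi> :: "'a \<Rightarrow> ereal"
  assumes "z \<in> argmin_set \<Phi>"
  shows "(INF y. \<Phi> y) = \<Phi> z"
  using assms by (intro antisym INF_lower INF_greatest) (auto simp: argmin_set_iff)

lemma argmin_set_finite: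
  assumes "proper_fun \<Phi>" "z \<in> argmin_set \<Phi>"
  obtains c where "\<Phi> z = ereal c"
proof -
  obtain y where "\<Phi> y \<noteq> \<infinity>" using assms(1) by (auto simp: proper_fun_def)
  moreover have "\<Phi> z \<le> \<Phi> y" using assms(2) by (simp add: argmin_set_iff)
  ultimately have "\<Phi> z \<noteq> \<infinity>" "\<Phi> z \<noteq> -\<infinity>" using assms(1) by (auto simp: proper_fun_def)
  then show ?thesis using that by (cases "\<Phi> z") auto
qed

text \<open>The subgradient inequality tested at \<open>z\<close> bounds \<open>\<Phi> (y n)\<close>
  by \<open>\<Phi> z - inner (z - y n) (v n)\<close>. The product tends to 0 because
  \<open>y\<close> is bounded and \<open>v\<close> tends to 0 in norm, so along \<open>r\<close> the
  points \<open>y\<close> eventually enter every sublevel set strictly above the minimum, and these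
  sets are weakly closed.\<close>

lemma weak_cluster_point_minimizes:
  fixes X :: "nat \<Rightarrow> 'a::{real_inner, banach}"
  assumes \<Phi>: "proper_fun \<Phi>" "lsc_fun \<Phi>" "convex_fun \<Phi>" and z: "z \<in> argmin_set \<Phi>"
    and sub: "\<And>n. v n \<in> subdiff \<Phi> (y n)"
    and yX: "weakly_tendsto (\<lambda>n. y n - X n) 0" and v: "v \<longlonglongrightarrow> 0"
    and X: "Bseq X" and r: "strict_mono r" and l: "weakly_tendsto (X \<circ> r) l"
  shows "l \<in> argmin_set \<Phi>"
proof -
  obtain c where c: "\<Phi> z = ereal c" using argmin_set_finite[OF \<Phi>(1) z] .
  obtain K1 K2 where "\<And>n. norm (y n - X n) \<le> K1" "\<And>n. norm (X n) \<le> K2"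
    using weakly_tendsto_imp_Bseq[OF yX] X by (auto simp: Bseq_def)
  then have K: "norm (y n) \<le> K1 + K2" for n
    using norm_triangle_ineq[of "y n - X n" "X n"] by (smt (verit) diff_add_cancel)
  have "(\<lambda>n. inner (z - y n) (v n)) \<longlonglongrightarrow> 0"
  proof (rule Lim_null_comparison)
    show "eventually (\<lambda>n. norm (inner (z - y n) (v n)) \<le> (norm z + (K1 + K2)) * norm (v n)) sequentially"
    proof (intro always_eventually allI)
      fix n
      have "norm (inner (z - y n) (v n)) \<le> norm (z - y n) * norm (v n)"
        using Cauchy_Schwarz_ineq2 by simp
      also have "\<dots> \<le> (norm z + (K1 + K2)) * norm (v n)"
        using norm_triangle_ineq4[of z "y n"] K[of n] by (intro mult_right_mono) auto
      finally show "norm (inner (z - y n) (v n)) \<le> (norm z + (K1 + K2)) * norm (v n)" .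
    qed
    show "(\<lambda>n. (norm z + (K1 + K2)) * norm (v n)) \<longlonglongrightarrow> 0"
      using tendsto_mult_right_zero[OF tendsto_norm_zero[OF v]] .
  qed
  then have lim: "(\<lambda>n. inner (z - y (r n)) (v (r n))) \<longlonglongrightarrow> 0"
    using LIMSEQ_subseq_LIMSEQ[OF _ r] by (auto simp: o_def)
  have "weakly_tendsto (y \<circ> r) l"
    unfolding weakly_tendsto_def
  proof
    fix u
    have "(\<lambda>n. inner (((\<lambda>n. y n - X n) \<circ> r) n) u + inner ((X \<circ> r) n) u) \<longlonglongrightarrow> inner 0 u + inner l u"
      using l weakly_tendsto_subseq[OF yX r] unfolding weakly_tendsto_def
      by (intro tendsto_add) blast+
    then show "(\<lambda>n. inner ((y \<circ> r) n) u) \<longlonglongrightarrow> inner l u" by (simp add: inner_diff_left)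
  qed
  then have "\<Phi> l \<le> ereal (c + e)" if "e > 0" for e
  proof -
    have "eventually (\<lambda>n. - e < inner (z - y (r n)) (v (r n))) sequentially"
      using order_tendstoD(1)[OF lim, of "- e"] that by simp
    then have "eventually (\<lambda>n. (y \<circ> r) n \<in> {w. \<Phi> w \<le> ereal (c + e)}) sequentially"
    proof eventually_elim
      case (elim n)
      have "ereal (inner (z - y (r n)) (v (r n))) + \<Phi> (y (r n)) \<le> ereal c"
        using sub[of "r n"] c by (simp add: subdiff_def) metis
      then show ?case using elim by (cases "\<Phi> (y (r n))") auto
    qed
    with \<open>weakly_tendsto (y \<circ> r) l\<close> have "l \<in> {w. \<Phi> w \<le> ereal (c + e)}"
      by (rule weakly_tendsto_in_closed_convex[OF _ closed_sublevel[OF \<Phi>(2)] convex_sublevel[OF \<Phi>(3)]])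
    then show ?thesis by simp
  qed
  then have "\<Phi> l \<le> \<Phi> z" using ereal_le_epsilon2[of "\<Phi> l" "ereal c"] by (simp add: c)
  then show ?thesis using z order_trans unfolding argmin_set_iff by blast
qed

text \<open>It is the norm, not its square, that is 1-Lipschitz in \<open>z\<close> uniformly in
  \<open>n\<close>, so the Cauchy property is shown for the norm and squared at the end. This passes
  from countably many minimizers to all of them on one path.\<close>

lemma convergent_norm_diff_closure:
  fixes X :: "nat \<Rightarrow> 'a::real_normed_vector"
  assumes conv: "\<And>d. d \<in> D \<Longrightarrow> convergent (\<lambda>n. (norm (X n - d))\<^sup>2)" and z: "z \<in> closure D"
  shows "convergent (\<lambda>n. (norm (X n - z))\<^sup>2)"
proof -
  have "Cauchy (\<lambda>n. norm (X n - z))"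
  proof (rule metric_CauchyI)
    fix e :: real assume "e > 0"
    then obtain d where d: "d \<in> D" "dist d z < e / 4"
      using z by (metis closure_approachable zero_less_divide_iff zero_less_numeral)
    have "convergent (\<lambda>n. sqrt ((norm (X n - d))\<^sup>2))"
      using conv[OF d(1)] tendsto_real_sqrt unfolding convergent_def by blast
    then have "Cauchy (\<lambda>n. norm (X n - d))" by (simp add: Cauchy_convergent_iff)
    then obtain N where N: "\<And>m n. m \<ge> N \<Longrightarrow> n \<ge> N \<Longrightarrow> dist (norm (X m - d)) (norm (X n - d)) < e / 2"
      using \<open>e > 0\<close> unfolding Cauchy_def by (meson half_gt_zero)
    have app: "\<bar>norm (X n - z) - norm (X n - d)\<bar> < e / 4" for n
      using norm_triangle_ineq3[of "X n - z" "X n - d"] d(2) by (simp add: dist_norm)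
    have "dist (norm (X m - z)) (norm (X n - z)) < e" if "m \<ge> N" "n \<ge> N" for m n
      using N[OF that] app[of m] app[of n] unfolding dist_real_def by linarith
    then show "\<exists>N. \<forall>m\<ge>N. \<forall>n\<ge>N. dist (norm (X m - z)) (norm (X n - z)) < e" by blast
  qed
  then show ?thesis by (simp add: Cauchy_convergent_iff power2_eq_square convergent_mult)
qed

text \<open>The terms with indices from \<open>n div 2\<close> to below \<open>n\<close> are at
  least \<open>f n\<close> each, and their sum is at most a tail of a convergent series. Rounding
  down leaves at least \<open>n / 2\<close> of them.\<close>

lemma decseq_summable_imp_mult_tendsto_0:
  fixes f :: "nat \<Rightarrow> real"
  assumes "decseq f" "\<And>n. 0 \<le> f n" "summable f"
  shows "(\<lambda>n. real n * f n) \<longlonglongrightarrow> 0"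
proof (rule tendsto_sandwich[of "\<lambda>_. 0" _ _ "\<lambda>n. 2 * (suminf f - (\<Sum>k<n div 2. f k))"])
  have "(\<lambda>m. \<Sum>k<m. f k) \<longlonglongrightarrow> suminf f" using assms(3) by (rule summable_LIMSEQ)
  moreover have "filterlim (\<lambda>n::nat. n div 2) sequentially sequentially"
    unfolding filterlim_at_top eventually_sequentially
    by (intro allI) (metis div_le_mono nonzero_mult_div_cancel_left zero_neq_numeral)
  ultimately have "(\<lambda>n. \<Sum>k<n div 2. f k) \<longlonglongrightarrow> suminf f" by (rule filterlim_compose)
  then have "(\<lambda>n. 2 * (suminf f - (\<Sum>k<n div 2. f k))) \<longlonglongrightarrow> 2 * (suminf f - suminf f)"
    by (intro tendsto_intros)
  then show "(\<lambda>n. 2 * (suminf f - (\<Sum>k<n div 2. f k))) \<longlonglongrightarrow> 0" by simp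
  show "eventually (\<lambda>n. real n * f n \<le> 2 * (suminf f - (\<Sum>k<n div 2. f k))) sequentially"
  proof (intro always_eventually allI)
    fix n
    have "real n * f n \<le> 2 * (real (n - n div 2) * f n)"
      unfolding mult.assoc[symmetric] using assms(2)[of n] by (intro mult_right_mono) auto
    also have "real (n - n div 2) * f n = (\<Sum>k=n div 2..<n. f n)" by simp
    also have "\<dots> \<le> (\<Sum>k=n div 2..<n. f k)"
      using assms(1) by (intro sum_mono) (auto simp: decseq_def)
    also have "\<dots> = (\<Sum>k<n. f k) - (\<Sum>k<n div 2. f k)"
      by (simp add: sum_diff_nat_ivl lessThan_atLeast0)
    also have "\<dots> \<le> suminf f - (\<Sum>k<n div 2. f k)"
      using assms by (intro diff_right_mono sum_le_suminf) auto
    finally show "real n * f n \<le> 2 * (suminf f - (\<Sum>k<n div 2. f k))" by simp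
  qed
qed (use assms(2) in auto)

section \<open>Processes with conditional descent\<close>

lemma ereal_integrableD:
  assumes "ereal_integrable M f"
  shows "f \<in> borel_measurable M" "integrable M (\<lambda>\<omega>. real_of_ereal (f \<omega>))"
    "AE \<omega> in M. \<bar>f \<omega>\<bar> \<noteq> \<infinity>"
proof -
  show [measurable]: "f \<in> borel_measurable M" using assms by (simp add: ereal_integrable_def)
  have fin: "(\<integral>\<^sup>+\<omega>. e2ennreal \<bar>f \<omega>\<bar> \<partial>M) < \<infinity>" using assms by (simp add: ereal_integrable_def)
  then have "AE \<omega> in M. e2ennreal \<bar>f \<omega>\<bar> \<noteq> \<infinity>"
    by (intro nn_integral_noteq_infinite) auto
  then show "AE \<omega> in M. \<bar>f \<omega>\<bar> \<noteq> \<infinity>" by eventually_elim auto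
  show "integrable M (\<lambda>\<omega>. real_of_ereal (f \<omega>))"
  proof (rule integrableI_bounded)
    have "(\<integral>\<^sup>+\<omega>. ennreal (norm (real_of_ereal (f \<omega>))) \<partial>M) \<le> (\<integral>\<^sup>+\<omega>. e2ennreal \<bar>f \<omega>\<bar> \<partial>M)"
    proof (rule nn_integral_mono)
      show "ennreal (norm (real_of_ereal (f \<omega>))) \<le> e2ennreal \<bar>f \<omega>\<bar>" for \<omega>
        by (cases "f \<omega>") auto
    qed
    with fin show "(\<integral>\<^sup>+\<omega>. ennreal (norm (real_of_ereal (f \<omega>))) \<partial>M) < \<infinity>" by (rule le_less_trans[rotated])
  qed simp
qed

text \<open>One choice of the witnesses in P2. The bound \<open>b\<close> on the total error stays
  outside: almost sure convergence asks for summability, the rate also for the bound.\<close>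

locale descent_process = prob_space M for M :: "'w measure" +
  fixes \<Phi> :: "'a::{real_normed_vector, second_countable_topology} \<Rightarrow> ereal"
    and x :: "nat \<Rightarrow> 'w \<Rightarrow> 'a" and x0 :: 'a
    and F :: "nat \<Rightarrow> 'w measure" and \<xi> :: "nat \<Rightarrow> 'w \<Rightarrow> real" and a :: real
  assumes proper: "proper_fun \<Phi>"
    and init: "\<And>\<omega>. \<omega> \<in> space M \<Longrightarrow> x 0 \<omega> = x0"
    and value_integrable: "\<And>n. ereal_integrable M (\<lambda>\<omega>. \<Phi> (x n \<omega>))"
    and subalg: "\<And>n. subalgebra M (F n)" and subalg_Suc: "\<And>n. subalgebra (F (Suc n)) (F n)"
    and adapted: "\<And>n. x n \<in> borel_measurable (F n)"
    and \<xi>_nonneg: "\<And>n \<omega>. \<omega> \<in> space M \<Longrightarrow> 0 \<le> \<xi> n \<omega>"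
    and \<xi>_integrable: "\<And>n. integrable M (\<xi> n)"
    and a_pos: "0 < a"
    and descent: "\<And>z n. z \<in> eff_dom \<Phi> \<Longrightarrow> AE \<omega> in M.
      enn2ereal (nn_cond_exp M (F n) (\<lambda>\<omega>'. ennreal ((norm (x (Suc n) \<omega>' - z))\<^sup>2)) \<omega>)
        \<le> ereal ((norm (x n \<omega> - z))\<^sup>2
            + a * ereal_cond_exp M (F n) (\<lambda>\<omega>'. \<Phi> z - \<Phi> (x (Suc n) \<omega>')) \<omega> + \<xi> n \<omega>)"
begin

abbreviation val :: "nat \<Rightarrow> 'w \<Rightarrow> real" where
  "val n \<omega> \<equiv> real_of_ereal (\<Phi> (x n \<omega>))"

abbreviation sqdist :: "'a \<Rightarrow> nat \<Rightarrow> 'w \<Rightarrow> real" where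
  "sqdist z n \<omega> \<equiv> (norm (x n \<omega> - z))\<^sup>2"

lemma x_measurable [measurable]: "x n \<in> borel_measurable M"
  using measurable_from_subalg[OF subalg adapted] .

lemma space_in_F: "space M \<in> sets (F n)"
  by (metis sets.top subalg subalgebra_def)

lemma val_integrable: "integrable M (val n)"
  using ereal_integrableD(2)[OF value_integrable] .

text \<open>Both claims come from one computation, the defining property of the conditional
  expectation on \<open>A\<close>, carried out in \<open>ennreal\<close>, where the new squared
  distance need not be integrable. The whole space as \<open>A\<close> gives the first claim, which
  then permits real integrals in the second.\<close>

lemma descent_step:
  assumes z: "z \<in> eff_dom \<Phi>" and int: "integrable M (sqdist z n)"
  shows "integrable M (sqdist z (Suc n))"
    and "A \<in> sets (F n) \<Longrightarrow> (\<integral>\<omega>. indicator A \<omega> * sqdist z (Suc n) \<omega> \<partial>M)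
      \<le> (\<integral>\<omega>. indicator A \<omega> * sqdist z n \<omega> \<partial>M)
        + a * (\<integral>\<omega>. indicator A \<omega> * (real_of_ereal (\<Phi> z) - val (Suc n) \<omega>) \<partial>M) + (\<integral>\<omega>. \<xi> n \<omega> \<partial>M)"
proof -
  interpret Fn: sigma_finite_subalgebra M "F n"
    by (intro finite_measure_subalgebra_is_sigma_finite finite_measure_subalgebra.intro
        finite_measure_subalgebra_axioms.intro subalg finite_measure_axioms)
  define g where "g \<omega> = real_of_ereal (\<Phi> z - \<Phi> (x (Suc n) \<omega>))" for \<omega>
  have \<Phi>z: "\<Phi> z = ereal (real_of_ereal (\<Phi> z))"
    using z proper by (auto simp: eff_dom_def proper_fun_def ereal_real)
  have [measurable]: "(\<lambda>\<omega>. \<Phi> (x (Suc n) \<omega>)) \<in> borel_measurable M"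
    using ereal_integrableD(1)[OF value_integrable] .
  have [measurable]: "g \<in> borel_measurable M" unfolding g_def by measurable
  \<comment> \<open>Splitting \<open>real_of_ereal\<close> over the difference is safe only where
    \<open>\<Phi> (x (Suc n) \<omega>)\<close> is finite, hence almost everywhere.\<close>
  have g: "AE \<omega> in M. g \<omega> = real_of_ereal (\<Phi> z) - val (Suc n) \<omega>"
    using ereal_integrableD(3)[OF value_integrable[of "Suc n"]]
  proof eventually_elim
    case (elim \<omega>)
    then show ?case unfolding g_def by (subst \<Phi>z) (cases "\<Phi> (x (Suc n) \<omega>)", auto)
  qed
  have int_diff: "integrable M (\<lambda>\<omega>. real_of_ereal (\<Phi> z) - val (Suc n) \<omega>)"
    using val_integrable by auto
  have int_g: "integrable M g"
    using int_diff by (subst integrable_cong_AE[OF _ _ g]) auto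
  define R where "R \<omega> = sqdist z n \<omega> + a * real_cond_exp M (F n) g \<omega> + \<xi> n \<omega>" for \<omega>
  define N where "N = nn_cond_exp M (F n) (\<lambda>\<omega>. ennreal (sqdist z (Suc n) \<omega>))"
  have [measurable]: "N \<in> borel_measurable M" unfolding N_def by simp
  have int_R: "integrable M R"
    unfolding R_def using int \<xi>_integrable Fn.real_cond_exp_int(1)[OF int_g] by auto
  have "AE \<omega> in M. enn2ereal (N \<omega>) \<le> ereal (R \<omega>)"
    using descent[OF z, of n] unfolding N_def R_def g_def ereal_cond_exp_def by simp
  \<comment> \<open>The nonnegative left-hand side forces \<open>R\<close> to be nonnegative almost
    everywhere, so turning it into an \<open>ennreal\<close> truncates nothing.\<close>
  then have NR: "AE \<omega> in M. N \<omega> \<le> ennreal (R \<omega>) \<and> 0 \<le> R \<omega>"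
  proof eventually_elim
    case (elim \<omega>)
    then have "e2ennreal (enn2ereal (N \<omega>)) \<le> e2ennreal (ereal (R \<omega>))" by (rule e2ennreal_mono)
    moreover have "0 \<le> ereal (R \<omega>)" using enn2ereal_nonneg elim by (rule order_trans)
    ultimately show ?case by simp
  qed
  have le: "(\<integral>\<^sup>+\<omega>. ennreal (indicator A \<omega> * sqdist z (Suc n) \<omega>) \<partial>M) \<le> ennreal (\<integral>\<omega>. indicator A \<omega> * R \<omega> \<partial>M)"
    and nonneg: "0 \<le> (\<integral>\<omega>. indicator A \<omega> * R \<omega> \<partial>M)" if A: "A \<in> sets (F n)" for A
  proof -
    have A' [measurable]: "A \<in> sets M" using A subalg by (meson subalgebra_def subsetD)
    have R0: "AE \<omega> in M. 0 \<le> indicator A \<omega> * R \<omega>"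
      using NR by eventually_elim simp
    then show "0 \<le> (\<integral>\<omega>. indicator A \<omega> * R \<omega> \<partial>M)" by (rule integral_nonneg_AE)
    have "(\<integral>\<^sup>+\<omega>. ennreal (indicator A \<omega> * sqdist z (Suc n) \<omega>) \<partial>M)
        = (\<integral>\<^sup>+\<omega>. indicator A \<omega> * ennreal (sqdist z (Suc n) \<omega>) \<partial>M)"
      by (intro nn_integral_cong) (simp add: indicator_def)
    also have "\<dots> = (\<integral>\<^sup>+\<omega>. indicator A \<omega> * N \<omega> \<partial>M)"
      unfolding N_def using A by (intro Fn.nn_cond_exp_intg[symmetric]) auto
    also have "\<dots> \<le> (\<integral>\<^sup>+\<omega>. ennreal (indicator A \<omega> * R \<omega>) \<partial>M)"
      using NR by (intro nn_integral_mono_AE) (auto simp: indicator_def)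
    also have "\<dots> = ennreal (\<integral>\<omega>. indicator A \<omega> * R \<omega> \<partial>M)"
      using R0 integrable_real_mult_indicator[OF A' int_R]
      by (intro nn_integral_eq_integral) (auto simp: mult.commute)
    finally show "(\<integral>\<^sup>+\<omega>. ennreal (indicator A \<omega> * sqdist z (Suc n) \<omega>) \<partial>M)
      \<le> ennreal (\<integral>\<omega>. indicator A \<omega> * R \<omega> \<partial>M)" .
  qed
  show int_Suc: "integrable M (sqdist z (Suc n))"
  proof (rule integrableI_nonneg)
    have "(\<integral>\<^sup>+\<omega>. ennreal (sqdist z (Suc n) \<omega>) \<partial>M)
        = (\<integral>\<^sup>+\<omega>. ennreal (indicator (space M) \<omega> * sqdist z (Suc n) \<omega>) \<partial>M)"
      by (intro nn_integral_cong) simp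
    also have "\<dots> \<le> ennreal (\<integral>\<omega>. indicator (space M) \<omega> * R \<omega> \<partial>M)"
      by (rule le[OF space_in_F])
    also have "\<dots> < \<infinity>" by simp
    finally show "(\<integral>\<^sup>+\<omega>. ennreal (sqdist z (Suc n) \<omega>) \<partial>M) < \<infinity>" .
  qed auto
  assume A: "A \<in> sets (F n)"
  then have A' [measurable]: "A \<in> sets M" using subalg by (meson subalgebra_def subsetD)
  have ind: "integrable M (\<lambda>\<omega>. indicator A \<omega> * f \<omega>)" if "integrable M f" for f :: "'w \<Rightarrow> real"
    using integrable_real_mult_indicator[OF A' that] by (simp add: mult.commute)
  have "ennreal (\<integral>\<omega>. indicator A \<omega> * sqdist z (Suc n) \<omega> \<partial>M)
      = (\<integral>\<^sup>+\<omega>. ennreal (indicator A \<omega> * sqdist z (Suc n) \<omega>) \<partial>M)"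
    using ind[OF int_Suc] by (intro nn_integral_eq_integral[symmetric]) auto
  then have "(\<integral>\<omega>. indicator A \<omega> * sqdist z (Suc n) \<omega> \<partial>M) \<le> (\<integral>\<omega>. indicator A \<omega> * R \<omega> \<partial>M)"
    using le[OF A] nonneg[OF A] by (metis ennreal_le_iff)
  also have "\<dots> = (\<integral>\<omega>. indicator A \<omega> * sqdist z n \<omega> + a * (indicator A \<omega> * real_cond_exp M (F n) g \<omega>)
      + indicator A \<omega> * \<xi> n \<omega> \<partial>M)"
    by (simp add: R_def algebra_simps)
  also have "\<dots> = (\<integral>\<omega>. indicator A \<omega> * sqdist z n \<omega> \<partial>M)
      + a * (\<integral>\<omega>. indicator A \<omega> * real_cond_exp M (F n) g \<omega> \<partial>M) + (\<integral>\<omega>. indicator A \<omega> * \<xi> n \<omega> \<partial>M)"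
    using ind[OF int] ind[OF \<xi>_integrable] ind[OF Fn.real_cond_exp_int(1)[OF int_g]] by simp
  also have "(\<integral>\<omega>. indicator A \<omega> * real_cond_exp M (F n) g \<omega> \<partial>M) = (\<integral>\<omega>. indicator A \<omega> * g \<omega> \<partial>M)"
    using A ind[OF int_g] by (intro Fn.real_cond_exp_intg(2)) auto
  also have "\<dots> = (\<integral>\<omega>. indicator A \<omega> * (real_of_ereal (\<Phi> z) - val (Suc n) \<omega>) \<partial>M)"
    using g int_diff by (intro integral_cong_AE) auto
  \<comment> \<open>Dropping the indicator makes the error independent of \<open>A\<close>, as the
    upcrossing estimate requires.\<close>
  also have "(\<integral>\<omega>. indicator A \<omega> * \<xi> n \<omega> \<partial>M) \<le> (\<integral>\<omega>. \<xi> n \<omega> \<partial>M)"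
    using ind[OF \<xi>_integrable] \<xi>_integrable \<xi>_nonneg by (intro integral_mono) (auto simp: indicator_def)
  finally show "(\<integral>\<omega>. indicator A \<omega> * sqdist z (Suc n) \<omega> \<partial>M)
      \<le> (\<integral>\<omega>. indicator A \<omega> * sqdist z n \<omega> \<partial>M)
        + a * (\<integral>\<omega>. indicator A \<omega> * (real_of_ereal (\<Phi> z) - val (Suc n) \<omega>) \<partial>M) + (\<integral>\<omega>. \<xi> n \<omega> \<partial>M)"
    by simp
qed

lemma sqdist_0: "integrable M (sqdist z 0)" "(\<integral>\<omega>. sqdist z 0 \<omega> \<partial>M) = (norm (x0 - z))\<^sup>2"
proof -
  have "integrable M (sqdist z 0) \<longleftrightarrow> integrable M (\<lambda>_. (norm (x0 - z))\<^sup>2)"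
    by (intro Bochner_Integration.integrable_cong) (auto simp: init)
  then show "integrable M (sqdist z 0)" by simp
  have "(\<integral>\<omega>. sqdist z 0 \<omega> \<partial>M) = (\<integral>\<omega>. (norm (x0 - z))\<^sup>2 \<partial>M)"
    by (intro Bochner_Integration.integral_cong) (auto simp: init)
  then show "(\<integral>\<omega>. sqdist z 0 \<omega> \<partial>M) = (norm (x0 - z))\<^sup>2" by (simp add: prob_space)
qed

lemma sqdist_integrable: "z \<in> eff_dom \<Phi> \<Longrightarrow> integrable M (sqdist z n)"
  by (induction n) (rule sqdist_0(1), rule descent_step(1))

lemma sum_gaps_le:
  assumes z: "z \<in> eff_dom \<Phi>"
  shows "a * (\<Sum>k<n. (\<integral>\<omega>. val (Suc k) \<omega> \<partial>M) - real_of_ereal (\<Phi> z))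
    \<le> (norm (x0 - z))\<^sup>2 + (\<Sum>k<n. \<integral>\<omega>. \<xi> k \<omega> \<partial>M)"
proof -
  \<comment> \<open>The expected squared distance is kept on the left so that the induction
    telescopes; being nonnegative, it is dropped afterwards.\<close>
  have "(\<integral>\<omega>. sqdist z n \<omega> \<partial>M) + a * (\<Sum>k<n. (\<integral>\<omega>. val (Suc k) \<omega> \<partial>M) - real_of_ereal (\<Phi> z))
    \<le> (norm (x0 - z))\<^sup>2 + (\<Sum>k<n. \<integral>\<omega>. \<xi> k \<omega> \<partial>M)"
  proof (induction n)
    case 0
    then show ?case by (simp add: sqdist_0)
  next
    case (Suc n)
    have ind: "(\<integral>\<omega>. indicator (space M) \<omega> * f \<omega> \<partial>M) = (\<integral>\<omega>. f \<omega> \<partial>M)" for f :: "'w \<Rightarrow> real"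
      by (intro Bochner_Integration.integral_cong) auto
    from descent_step(2)[OF z sqdist_integrable[OF z] space_in_F]
    have "(\<integral>\<omega>. sqdist z (Suc n) \<omega> \<partial>M) \<le> (\<integral>\<omega>. sqdist z n \<omega> \<partial>M)
        + a * (real_of_ereal (\<Phi> z) - (\<integral>\<omega>. val (Suc n) \<omega> \<partial>M)) + (\<integral>\<omega>. \<xi> n \<omega> \<partial>M)"
      using val_integrable unfolding ind by (simp add: prob_space)
    with Suc show ?case by (simp add: algebra_simps)
  qed
  moreover have "0 \<le> (\<integral>\<omega>. sqdist z n \<omega> \<partial>M)" by simp
  ultimately show ?thesis by linarith
qed

text \<open>The descent step evaluates the function at the new point, so the sum runs over the times
  1 to \<open>n\<close>. Each of these \<open>n\<close> gaps is at least the last one, which yields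
  exactly the factor \<open>n\<close>.\<close>

lemma gap_le:
  assumes z: "z \<in> eff_dom \<Phi>" and dec: "decseq (\<lambda>n. \<integral>\<omega>. val n \<omega> \<partial>M)"
    and b: "summable (\<lambda>n. \<integral>\<omega>. \<xi> n \<omega> \<partial>M)" "(\<Sum>n. \<integral>\<omega>. \<xi> n \<omega> \<partial>M) \<le> b"
  shows "a * (real n * ((\<integral>\<omega>. val n \<omega> \<partial>M) - real_of_ereal (\<Phi> z))) \<le> (norm (x0 - z))\<^sup>2 + b"
proof -
  have "real n * ((\<integral>\<omega>. val n \<omega> \<partial>M) - real_of_ereal (\<Phi> z))
      = (\<Sum>k<n. (\<integral>\<omega>. val n \<omega> \<partial>M) - real_of_ereal (\<Phi> z))" by simp
  also have "\<dots> \<le> (\<Sum>k<n. (\<integral>\<omega>. val (Suc k) \<omega> \<partial>M) - real_of_ereal (\<Phi> z))"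
    using dec by (intro sum_mono diff_right_mono) (auto simp: decseq_def)
  finally have "a * (real n * ((\<integral>\<omega>. val n \<omega> \<partial>M) - real_of_ereal (\<Phi> z)))
      \<le> (norm (x0 - z))\<^sup>2 + (\<Sum>k<n. \<integral>\<omega>. \<xi> k \<omega> \<partial>M)"
    using sum_gaps_le[OF z, of n] a_pos by (meson mult_left_mono less_imp_le order_trans)
  moreover have "(\<Sum>k<n. \<integral>\<omega>. \<xi> k \<omega> \<partial>M) \<le> (\<Sum>n. \<integral>\<omega>. \<xi> n \<omega> \<partial>M)"
    using b(1) \<xi>_nonneg by (intro sum_le_suminf) (auto intro: integral_nonneg_AE)
  ultimately show ?thesis using b(2) by linarith
qed

lemma sqdist_AE_convergent:
  assumes z: "z \<in> argmin_set \<Phi>" and b: "summable (\<lambda>n. \<integral>\<omega>. \<xi> n \<omega> \<partial>M)"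
  shows "AE \<omega> in M. convergent (\<lambda>n. sqdist z n \<omega>)"
proof (rule quasi_supermartingale_AE_convergent[of F, OF subalg subalg_Suc])
  obtain c where c: "\<Phi> z = ereal c" using argmin_set_finite[OF proper z] .
  then have dom: "z \<in> eff_dom \<Phi>" by (simp add: eff_dom_def)
  show "sqdist z n \<in> borel_measurable (F n)" for n using adapted[of n] by measurable
  show "integrable M (sqdist z n)" for n using sqdist_integrable[OF dom] .
  show "summable (\<lambda>n. \<integral>\<omega>. \<xi> n \<omega> \<partial>M)" by fact
  show "0 \<le> (\<integral>\<omega>. \<xi> n \<omega> \<partial>M)" for n using \<xi>_nonneg by (intro integral_nonneg_AE) auto
  fix n A assume A: "A \<in> sets (F n)"
  have "(\<integral>\<omega>. indicator A \<omega> * (val (Suc n) \<omega> - real_of_ereal (\<Phi> z)) \<partial>M) \<ge> 0"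
  proof (rule integral_nonneg_AE)
    show "AE \<omega> in M. 0 \<le> indicator A \<omega> * (val (Suc n) \<omega> - real_of_ereal (\<Phi> z))"
      using ereal_integrableD(3)[OF value_integrable[of "Suc n"]]
    proof eventually_elim
      case (elim \<omega>)
      have "ereal c \<le> \<Phi> (x (Suc n) \<omega>)" using z c by (metis argmin_set_iff)
      then show ?case using elim c by (cases "\<Phi> (x (Suc n) \<omega>)") auto
    qed
  qed
  moreover have "(\<integral>\<omega>. indicator A \<omega> * (real_of_ereal (\<Phi> z) - val (Suc n) \<omega>) \<partial>M)
      = - (\<integral>\<omega>. indicator A \<omega> * (val (Suc n) \<omega> - real_of_ereal (\<Phi> z)) \<partial>M)"
    by (subst Bochner_Integration.integral_minus[symmetric]) (simp add: algebra_simps)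
  ultimately have "(\<integral>\<omega>. indicator A \<omega> * (real_of_ereal (\<Phi> z) - val (Suc n) \<omega>) \<partial>M) \<le> 0"
    by linarith
  then show "(\<integral>\<omega>. indicator A \<omega> * sqdist z (Suc n) \<omega> \<partial>M)
      \<le> (\<integral>\<omega>. indicator A \<omega> * sqdist z n \<omega> \<partial>M) + (\<integral>\<omega>. \<xi> n \<omega> \<partial>M)"
    using descent_step(2)[OF dom sqdist_integrable[OF dom] A] a_pos
      mult_nonneg_nonpos[of a] by fastforce
qed simp

end

section \<open>Lower bound for expected values, measurable weak limits and conclusion\<close>

lemma (in prob_space) INF_le_ereal_expectation:
  assumes int: "ereal_integrable M (\<lambda>\<omega>. \<Phi> (X \<omega>))" and fin: "(INF z. \<Phi> z) \<noteq> \<infinity>"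
  shows "(INF z. \<Phi> z) \<le> ereal (ereal_expectation M (\<lambda>\<omega>. \<Phi> (X \<omega>)))"
proof (cases "INF z. \<Phi> z")
  case (real c)
  have "c = (\<integral>\<omega>. c \<partial>M)" by (simp add: prob_space)
  also have "\<dots> \<le> (\<integral>\<omega>. real_of_ereal (\<Phi> (X \<omega>)) \<partial>M)"
  proof (rule integral_mono_AE)
    show "AE \<omega> in M. c \<le> real_of_ereal (\<Phi> (X \<omega>))"
      using ereal_integrableD(3)[OF int]
    proof eventually_elim
      case (elim \<omega>)
      have "ereal c \<le> \<Phi> (X \<omega>)" unfolding real[symmetric] by (rule INF_lower) simp
      then show ?case using elim by (cases "\<Phi> (X \<omega>)") auto
    qed
  qed (use ereal_integrableD(2)[OF int] in auto)
  finally show ?thesis by (simp add: real ereal_expectation_def)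
qed (use fin in auto)

text \<open>The limit is picked by \<open>SOME\<close> on each path, which says nothing about
  measurability. It is recovered from the products with fixed vectors, which are pointwise limits of
  measurable functions.\<close>

lemma (in prob_space) AE_weak_limit_measurable:
  fixes X :: "nat \<Rightarrow> 'a \<Rightarrow> 'b::{real_inner, second_countable_topology}"
  assumes X [measurable]: "\<And>n. X n \<in> borel_measurable M" and s: "s \<in> S"
    and ae: "AE \<omega> in M. \<exists>l\<in>S. weakly_tendsto (\<lambda>n. X n \<omega>) l"
  obtains L where "L \<in> borel_measurable M" "\<And>\<omega>. L \<omega> \<in> S"
    "AE \<omega> in M. weakly_tendsto (\<lambda>n. X n \<omega>) (L \<omega>)"
proof -
  obtain N where N: "{\<omega>\<in>space M. \<not> (\<exists>l\<in>S. weakly_tendsto (\<lambda>n. X n \<omega>) l)} \<subseteq> N"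
      "emeasure M N = 0" and [measurable]: "N \<in> sets M"
    using AE_E[OF ae] by blast
  \<comment> \<open>The event of convergence is not known to be measurable, so a measurable null set
    covering its complement is removed; off \<open>G\<close> the value \<open>s\<close> is
    used.\<close>
  define G where "G = space M - N"
  have [measurable]: "G \<in> sets M" unfolding G_def by simp
  have ex: "\<exists>l\<in>S. weakly_tendsto (\<lambda>n. X n \<omega>) l" if "\<omega> \<in> G" for \<omega> using that N(1) by (auto simp: G_def)
  define L where "L \<omega> = (if \<omega> \<in> G then SOME l. l \<in> S \<and> weakly_tendsto (\<lambda>n. X n \<omega>) l else s)" for \<omega>
  have L: "L \<omega> \<in> S \<and> weakly_tendsto (\<lambda>n. X n \<omega>) (L \<omega>)" if "\<omega> \<in> G" for \<omega>
    unfolding L_def using ex[OF that] that by (auto intro: someI2_bex)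
  have "L \<in> borel_measurable M"
  proof (rule borel_measurable_if_inner_measurable)
    fix u
    show "(\<lambda>\<omega>. inner (L \<omega>) u) \<in> borel_measurable M"
    proof (rule borel_measurable_LIMSEQ_real)
      show "(\<lambda>\<omega>. if \<omega> \<in> G then inner (X n \<omega>) u else inner s u) \<in> borel_measurable M" for n
        by measurable
      show "(\<lambda>n. if \<omega> \<in> G then inner (X n \<omega>) u else inner s u) \<longlonglongrightarrow> inner (L \<omega>) u" for \<omega>
        using L[of \<omega>] by (cases "\<omega> \<in> G") (auto simp: weakly_tendsto_def L_def)
    qed
  qed
  moreover have "L \<omega> \<in> S" for \<omega> using L[of \<omega>] s by (cases "\<omega> \<in> G") (auto simp: L_def)
  moreover have "AE \<omega> in M. \<omega> \<in> G"
    using N(2) by (intro AE_I[of _ _ N]) (auto simp: G_def)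
  then have "AE \<omega> in M. weakly_tendsto (\<lambda>n. X n \<omega>) (L \<omega>)" by eventually_elim (use L in blast)
  ultimately show ?thesis using that by blast
qed

theorem theorem4p1:
  fixes M :: "'w measure"
    and \<Phi> :: "'a::{real_inner, banach, second_countable_topology} \<Rightarrow> ereal"
    and x :: "nat \<Rightarrow> 'w \<Rightarrow> 'a"
    and x0 :: 'a
  assumes "prob_space M"
    and "proper_fun \<Phi>" and "lsc_fun \<Phi>" and "convex_fun \<Phi>"
    and "\<And>n. x n \<in> borel_measurable M"
    and "\<And>\<omega>. \<omega> \<in> space M \<Longrightarrow> x 0 \<omega> = x0" and "x0 \<in> eff_dom \<Phi>"
    and "\<And>n. ereal_integrable M (\<lambda>\<omega>. \<Phi> (x n \<omega>))"
    and P1: "decseq (\<lambda>n. ereal_expectation M (\<lambda>\<omega>. \<Phi> (x n \<omega>)))"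
    and P2: "(INF n. ereal (ereal_expectation M (\<lambda>\<omega>. \<Phi> (x n \<omega>)))) > -\<infinity>
               \<Longrightarrow> \<exists>a b. cond_descent M \<Phi> x a b"
  shows "((\<lambda>n. ereal (ereal_expectation M (\<lambda>\<omega>. \<Phi> (x n \<omega>)))) \<longlonglongrightarrow> (INF z. \<Phi> z))
    \<and> (argmin_set \<Phi> \<noteq> {} \<longrightarrow>
         (\<lambda>n. ereal_expectation M (\<lambda>\<omega>. \<Phi> (x n \<omega>)) - real_of_ereal (INF z. \<Phi> z))
           \<in> o(\<lambda>n. 1 / real n)
       \<and> (\<forall>a b. cond_descent M \<Phi> x a b \<longrightarrow>
            (\<forall>n\<ge>1. ereal (ereal_expectation M (\<lambda>\<omega>. \<Phi> (x n \<omega>))) - (INF z. \<Phi> z)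
               \<le> ereal (((infdist x0 (argmin_set \<Phi>))\<^sup>2 / a + b / a) * (1 / real n)))))
    \<and> (asymp_critical M \<Phi> x \<and> argmin_set \<Phi> \<noteq> {} \<longrightarrow>
         (\<exists>xs. xs \<in> borel_measurable M \<and> (\<forall>\<omega>\<in>space M. xs \<omega> \<in> argmin_set \<Phi>) \<and>
            (AE \<omega> in M. weakly_tendsto (\<lambda>n. x n \<omega>) (xs \<omega>))))"
proof -
  interpret prob_space M by fact
  define E where "E n = ereal_expectation M (\<lambda>\<omega>. \<Phi> (x n \<omega>))" for n
  have E_eq: "E n = (\<integral>\<omega>. real_of_ereal (\<Phi> (x n \<omega>)) \<partial>M)" for n
    by (simp add: E_def ereal_expectation_def)
  have decE: "decseq E" using P1 by (simp add: E_def[abs_def])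
  let ?m = "INF z. \<Phi> z"
  let ?S = "argmin_set \<Phi>"
  have "?m \<le> \<Phi> x0" by (rule INF_lower) simp
  then have m_fin: "?m \<noteq> \<infinity>" using assms(7) by (auto simp: eff_dom_def)
  have m_le: "?m \<le> ereal (E n)" for n
    unfolding E_def using INF_le_ereal_expectation[OF assms(8) m_fin] .
  have unpack: "\<exists>F \<xi>. descent_process M \<Phi> x x0 F \<xi> a \<and>
      summable (\<lambda>n. \<integral>\<omega>. \<xi> n \<omega> \<partial>M) \<and> (\<Sum>n. \<integral>\<omega>. \<xi> n \<omega> \<partial>M) \<le> b"
    if cd: "cond_descent M \<Phi> x a b" for a b
  proof -
    from cd[unfolded cond_descent_def] obtain F \<xi> where *:
      "\<forall>n. subalgebra M (F n)" "\<forall>n. subalgebra (F (Suc n)) (F n)"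
      "\<forall>n. x n \<in> borel_measurable (F n)" "\<forall>n. \<forall>\<omega>\<in>space M. 0 \<le> \<xi> n \<omega>"
      "\<forall>n. integrable M (\<xi> n)" "a > 0"
      "\<forall>z\<in>eff_dom \<Phi>. \<forall>n. AE \<omega> in M.
           enn2ereal (nn_cond_exp M (F n) (\<lambda>\<omega>'. ennreal ((norm (x (Suc n) \<omega>' - z))\<^sup>2)) \<omega>)
             \<le> ereal ((norm (x n \<omega> - z))\<^sup>2
                 + a * ereal_cond_exp M (F n) (\<lambda>\<omega>'. \<Phi> z - \<Phi> (x (Suc n) \<omega>')) \<omega>
                 + \<xi> n \<omega>)"
      and b: "summable (\<lambda>n. \<integral>\<omega>. \<xi> n \<omega> \<partial>M)" "(\<Sum>n. \<integral>\<omega>. \<xi> n \<omega> \<partial>M) \<le> b"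
      by (elim exE conjE) blast
    have "descent_process M \<Phi> x x0 F \<xi> a"
      using assms(2,6,8) * by unfold_locales blast+
    then show ?thesis using b by blast
  qed
  have gap: "a * (real n * (E n - real_of_ereal (\<Phi> z))) \<le> (norm (x0 - z))\<^sup>2 + b"
    if cd: "cond_descent M \<Phi> x a b" and z: "z \<in> eff_dom \<Phi>" for a b z n
  proof -
    obtain F \<xi> where F: "descent_process M \<Phi> x x0 F \<xi> a"
      and b: "summable (\<lambda>n. \<integral>\<omega>. \<xi> n \<omega> \<partial>M)" "(\<Sum>n. \<integral>\<omega>. \<xi> n \<omega> \<partial>M) \<le> b"
      using unpack[OF cd] by blast
    show ?thesis
      unfolding E_eq using descent_process.gap_le[OF F z _ b] decE by (simp add: E_eq[abs_def])
  qed
  have pos: "a > 0" if "cond_descent M \<Phi> x a b" for a b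
    using that unfolding cond_descent_def by blast

  have i: "(\<lambda>n. ereal (E n)) \<longlonglongrightarrow> ?m"
  proof (rule order_tendstoI)
    fix u assume "u < ?m"
    then show "eventually (\<lambda>n. u < ereal (E n)) sequentially"
      by (intro always_eventually allI) (rule less_le_trans[OF _ m_le])
  next
    fix u assume u: "?m < u"
    have "\<exists>n. ereal (E n) < u"
    proof (cases "(INF n. ereal (E n)) > -\<infinity>")
      case False
      then have "(INF n. ereal (E n)) = -\<infinity>" by simp
      moreover have "-\<infinity> < u" using u by (rule le_less_trans[rotated]) simp
      ultimately have "(INF n. ereal (E n)) < u" by (rule ord_eq_less_trans)
      then show ?thesis by (simp add: INF_less_iff)
    next
      case True
      then obtain a b where cd: "cond_descent M \<Phi> x a b" using P2 by (auto simp: E_def)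
      obtain z where z: "\<Phi> z < u" using u by (auto simp: INF_less_iff)
      then have dom: "z \<in> eff_dom \<Phi>" by (auto simp: eff_dom_def)
      then obtain c where c: "\<Phi> z = ereal c"
        using assms(2) by (cases "\<Phi> z") (auto simp: eff_dom_def proper_fun_def)
      \<comment> \<open>\<open>u\<close> may be infinite; a real level \<open>d\<close> strictly
        above \<open>c\<close> provides the positive margin \<open>d - c\<close>. Then
        \<open>n\<close> is taken so large that \<open>E n \<ge> d\<close> would violate
        \<open>gap\<close>.\<close>
      obtain d where d: "c < d" "ereal d < u"
        using ereal_dense2[OF z] by (auto simp: c)
      obtain n where n: "real n > ((norm (x0 - z))\<^sup>2 + b) / (a * (d - c))"
        using reals_Archimedean2 by blast
      have "E n < d"
      proof (rule ccontr)
        assume "\<not> E n < d"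
        then have "a * (real n * (d - c)) \<le> a * (real n * (E n - c))"
          using pos[OF cd] by (intro mult_left_mono) auto
        also have "\<dots> \<le> (norm (x0 - z))\<^sup>2 + b" using gap[OF cd dom, of n] c by simp
        finally show False using n pos[OF cd] d(1) by (simp add: field_simps)
      qed
      then show ?thesis using d(2) by (meson ereal_less_eq(3) less_imp_le order_le_less_trans)
    qed
    then obtain n where n: "ereal (E n) < u" by blast
    have "ereal (E k) < u" if "k \<ge> n" for k
      using decseqD[OF decE that] n by (meson ereal_less_eq(3) order_le_less_trans)
    then show "eventually (\<lambda>n. ereal (E n) < u) sequentially"
      unfolding eventually_sequentially by blast
  qed

  have main: "(\<lambda>n. E n - real_of_ereal ?m) \<in> o(\<lambda>n. 1 / real n)
       \<and> (\<forall>a b. cond_descent M \<Phi> x a b \<longrightarrow>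
            (\<forall>n\<ge>1. ereal (E n) - ?m \<le> ereal (((infdist x0 ?S)\<^sup>2 / a + b / a) * (1 / real n))))
       \<and> (asymp_critical M \<Phi> x \<longrightarrow>
         (\<exists>xs. xs \<in> borel_measurable M \<and> (\<forall>\<omega>\<in>space M. xs \<omega> \<in> ?S) \<and>
            (AE \<omega> in M. weakly_tendsto (\<lambda>n. x n \<omega>) (xs \<omega>))))" if ne: "?S \<noteq> {}"
  proof -
    obtain s where s: "s \<in> ?S" using ne by blast
    obtain c where c: "\<Phi> s = ereal c" using argmin_set_finite[OF assms(2) s] .
    have m: "?m = ereal c" using argmin_set_INF[OF s] c by simp
    have Sc: "\<Phi> z = ereal c" if "z \<in> ?S" for z using argmin_set_INF[OF that] m by simp
    have Sdom: "z \<in> eff_dom \<Phi>" if "z \<in> ?S" for z using Sc[OF that] by (simp add: eff_dom_def)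
    have cE: "c \<le> E n" for n using m_le[of n] m by simp
    \<comment> \<open>A minimizer bounds the expected values below, which is what makes P2
      available.\<close>
    have "ereal c \<le> (INF n. ereal (E n))" using cE by (intro INF_greatest) simp
    then have "(INF n. ereal (E n)) > -\<infinity>" by (rule less_le_trans[rotated]) simp
    then obtain a b where cd: "cond_descent M \<Phi> x a b" using P2 by (auto simp: E_def)
    obtain F \<xi> where F: "descent_process M \<Phi> x x0 F \<xi> a"
      and b: "summable (\<lambda>n. \<integral>\<omega>. \<xi> n \<omega> \<partial>M)" "(\<Sum>n. \<integral>\<omega>. \<xi> n \<omega> \<partial>M) \<le> b"
      using unpack[OF cd] by blast
    interpret dp: descent_process M \<Phi> x x0 F \<xi> a by (rule F)

    have "summable (\<lambda>k. E (Suc k) - c)"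
    proof (rule summableI_nonneg_bounded)
      fix n
      have "a * (\<Sum>k<n. E (Suc k) - c) \<le> (norm (x0 - s))\<^sup>2 + (\<Sum>k<n. \<integral>\<omega>. \<xi> k \<omega> \<partial>M)"
        using dp.sum_gaps_le[OF Sdom[OF s], of n] c by (simp add: E_eq)
      also have "\<dots> \<le> (norm (x0 - s))\<^sup>2 + (\<Sum>n. \<integral>\<omega>. \<xi> n \<omega> \<partial>M)"
        using b(1) dp.\<xi>_nonneg by (intro add_left_mono sum_le_suminf) (auto intro: integral_nonneg_AE)
      finally show "(\<Sum>k<n. E (Suc k) - c) \<le> ((norm (x0 - s))\<^sup>2 + (\<Sum>n. \<integral>\<omega>. \<xi> n \<omega> \<partial>M)) / a"
        using pos[OF cd] by (simp add: field_simps)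
    qed (use cE in simp)
    then have "summable (\<lambda>n. E n - c)" using summable_Suc_iff[of "\<lambda>n. E n - c"] by simp
    then have lim: "(\<lambda>n. real n * (E n - c)) \<longlonglongrightarrow> 0"
      using decE cE by (intro decseq_summable_imp_mult_tendsto_0) (auto simp: decseq_def)
    have ii1: "(\<lambda>n. E n - real_of_ereal ?m) \<in> o(\<lambda>n. 1 / real n)"
    proof (rule smalloI_tendsto)
      show "(\<lambda>n. (E n - real_of_ereal ?m) / (1 / real n)) \<longlonglongrightarrow> 0"
        using lim by (simp add: m mult.commute)
      show "eventually (\<lambda>n. 1 / real n \<noteq> 0) sequentially"
        using eventually_gt_at_top[of 0] by eventually_elim simp
    qed

    have ii2: "ereal (E n) - ?m \<le> ereal (((infdist x0 ?S)\<^sup>2 / a + b / a) * (1 / real n))"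
      if cd: "cond_descent M \<Phi> x a b" and n: "n \<ge> 1" for a b n
    proof -
      \<comment> \<open>\<open>q\<close> does not depend on the minimizer, so the infimum over
        \<open>z\<close> can be taken. It is an infimum of distances, hence the square root; for
        \<open>q \<le> 0\<close> the claim is immediate.\<close>
      define q where "q = a * (real n * (E n - c)) - b"
      have q: "q \<le> (norm (x0 - z))\<^sup>2" if "z \<in> ?S" for z
        using gap[OF cd Sdom[OF that], of n] Sc[OF that] by (simp add: q_def)
      have "q \<le> (infdist x0 ?S)\<^sup>2"
      proof (cases "q \<le> 0")
        case False
        have "sqrt q \<le> dist x0 z" if "z \<in> ?S" for z
          using q[OF that] by (simp add: dist_norm real_le_lsqrt real_sqrt_le_iff real_sqrt_le_mono sqrt_le_D)
        then have "sqrt q \<le> infdist x0 ?S"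
          using ne by (simp add: infdist_def le_cINF_iff cINF_greatest)
        then show ?thesis using False by (simp add: sqrt_le_D)
      qed (meson order_trans zero_le_power2)
      then have "E n - c \<le> ((infdist x0 ?S)\<^sup>2 / a + b / a) * (1 / real n)"
        using pos[OF cd] n by (simp add: q_def field_simps)
      then show ?thesis by (simp add: m)
    qed

    have iii: "\<exists>xs. xs \<in> borel_measurable M \<and> (\<forall>\<omega>\<in>space M. xs \<omega> \<in> ?S) \<and>
            (AE \<omega> in M. weakly_tendsto (\<lambda>n. x n \<omega>) (xs \<omega>))" if crit: "asymp_critical M \<Phi> x"
    proof -
      obtain y v where yv: "AE \<omega> in M. (\<forall>n. v n \<omega> \<in> subdiff \<Phi> (y n \<omega>)) \<and>
           weakly_tendsto (\<lambda>n. y n \<omega> - x n \<omega>) 0 \<and> (\<lambda>n. v n \<omega>) \<longlonglongrightarrow> 0"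
        using crit unfolding asymp_critical_def by blast
      \<comment> \<open>\<open>D\<close> has to consist of minimizers, since almost sure convergence
        of the distances is established for these.\<close>
      obtain D where D: "countable D" "D \<subseteq> ?S" "?S \<subseteq> closure D" using separable by blast
      have "AE \<omega> in M. \<forall>d\<in>D. convergent (\<lambda>n. (norm (x n \<omega> - d))\<^sup>2)"
        using D dp.sqdist_AE_convergent[OF _ b(1)] by (intro AE_ball_countable[THEN iffD2]) auto
      with yv have "AE \<omega> in M. \<exists>l\<in>?S. weakly_tendsto (\<lambda>n. x n \<omega>) l"
      proof eventually_elim
        case (elim \<omega>)
        have conv: "convergent (\<lambda>n. (norm (x n \<omega> - z))\<^sup>2)" if "z \<in> ?S" for z
          using convergent_norm_diff_closure[of D "\<lambda>n. x n \<omega>" z] elim D(3) that by blast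
        show ?case
        proof (rule Opial[OF ne conv])
          fix r l assume "strict_mono (r :: nat \<Rightarrow> nat)" "weakly_tendsto ((\<lambda>n. x n \<omega>) \<circ> r) l"
          then show "l \<in> ?S"
            using elim Bseq_if_convergent_norm_diff[OF conv[OF s]]
            by (intro weak_cluster_point_minimizes[OF assms(2-4) s]) auto
        qed blast+
      qed
      then obtain L where "L \<in> borel_measurable M" "\<And>\<omega>. L \<omega> \<in> ?S"
          "AE \<omega> in M. weakly_tendsto (\<lambda>n. x n \<omega>) (L \<omega>)"
        using AE_weak_limit_measurable[of x, OF assms(5) s] by blast
      then show ?thesis by blast
    qed
    show ?thesis using ii1 ii2 iii by blast
  qed
  show ?thesis using i main unfolding E_def by blast
qed

end
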